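(* Let $m\geq 1$ and $k\geq 3$ be fixed integers, let $\mathcal{F}$ be a $k$-independent family of subsets of $[m]=\{1,\ldots,m\}$, and let $\epsilon_I=\sum_{i\in I}10^{-i-m}$ for $I\in\mathcal{F}$. Then the polytope $$P_k(V^\epsilon(\mathcal{F}),m):=\mathrm{conv}\left(\Psi_{k,m}(t):\ t\in V^\epsilon(\mathcal{F})\right)$$ is a centrally symmetric $k$-neighborly polytope of dimension at most $2k(m+1)-2m\lfloor (k+1)/3\rfloor$ that has $2|\mathcal{F}|$ vertices.
   Context: $\mathbb{S}=\mathbb{R}/2\pi\mathbb{Z}$. A family $\mathcal{F}$ of subsets of $[m]$ is $k$-independent if for every $k$ distinct members $I_1,\ldots,I_k$ of $\mathcal{F}$ all $2^k$ intersections $\bigcap_{j=1}^k J_j$, where each $J_j$ is either $I_j$ or its complement $I_j^c=[m]\setminus I_j$, are non-empty. For $I\subset[m]$ and $a\in\{0,1\}$ define a sequence $x(I,a)=(x_0,\ldots,x_m)$ of zeros and ones recursively by $x_0=a$ and, for $1\le n\le m$, $x_n\equiv\sum_{j=0}^{n-1}x_j \pmod 2$ if $n\notin I$, and $x_n\equiv 1+\sum_{j=0}^{n-1}x_j\pmod 2$ if $n\in I$. Put $t(I,a)=\pi\sum_{j=0}^m x_j/3^j\in\mathbb{S}$. Given numbers $\epsilon_I$ for $I\in\mathcal{F}$, put $$V^\epsilon(\mathcal{F})=\bigcup_{I\in\mathcal{F}}\{t(I,0)+\pi\epsilon_I,\ t(I^c,1)+\pi\epsilon_I\}\subset\mathbb{S}.$$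 $U_k:\mathbb{S}\to\mathbb{R}^{2k}$ is the curve $U_k(t)=(\cos t,\sin t,\cos 3t,\sin 3t,\ldots,\cos(2k-1)t,\sin(2k-1)t)$ (all odd frequencies from $1$ to $2k-1$), and $\Psi_{k,m}:\mathbb{S}\to\mathbb{R}^{2k(m+1)}$ is $\Psi_{k,m}(t)=(U_k(t),U_k(3t),U_k(3^2t),\ldots,U_k(3^mt))$. A polytope $P$ is centrally symmetric if $P=-P$; two vertices $v,w$ are antipodes if $w=-v$. A centrally symmetric polytope is $k$-neighborly if every set of $k$ of its vertices, no two of which are antipodes, is the vertex set of a $(k-1)$-dimensional face. *)

theory Defs
  imports "HOL-Analysis.Analysis"
begin

definition k_independent :: "nat \<Rightarrow> nat \<Rightarrow> nat set set \<Rightarrow> bool" where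
  "k_independent m k \<F> \<longleftrightarrow>
     (\<forall>I J :: nat \<Rightarrow> nat set.
        inj_on I {1..k} \<and> I ` {1..k} \<subseteq> \<F> \<and>
        (\<forall>j\<in>{1..k}. J j = I j \<or> J j = {1..m} - I j)
        \<longrightarrow> (\<Inter>j\<in>{1..k}. J j) \<noteq> {})"

fun xseq :: "nat set \<Rightarrow> nat \<Rightarrow> nat \<Rightarrow> nat" where
  "xseq I a 0 = a"
| "xseq I a (Suc n) =
     (if Suc n \<notin> I then (\<Sum>j\<le>n. xseq I a j) mod 2
      else (1 + (\<Sum>j\<le>n. xseq I a j)) mod 2)"

text \<open>Points of the circle \<open>\<real> / 2\<pi>\<int>\<close> are given by real representatives, and functions on
  the circle by \<open>2\<pi>\<close>-periodic functions of a real variable; periodicity of the curve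
  is \<open>Psi_periodic\<close> below.\<close>

definition tpoint :: "nat \<Rightarrow> nat set \<Rightarrow> nat \<Rightarrow> real" where
  "tpoint m I a = pi * (\<Sum>j\<le>m. real (xseq I a j) / 3 ^ j)"

definition Veps :: "nat \<Rightarrow> (nat set \<Rightarrow> real) \<Rightarrow> nat set set \<Rightarrow> real set" where
  "Veps m \<epsilon> \<F> =
     (\<Union>I\<in>\<F>. {tpoint m I 0 + pi * \<epsilon> I, tpoint m ({1..m} - I) 1 + pi * \<epsilon> I})"

definition U_list :: "nat \<Rightarrow> real \<Rightarrow> real list" where
  "U_list k t = concat (map (\<lambda>i. [cos (real (2 * i + 1) * t), sin (real (2 * i + 1) * t)]) [0..<k])"

definition Psi_list :: "nat \<Rightarrow> nat \<Rightarrow> real \<Rightarrow> real list" where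
  "Psi_list k m t = concat (map (\<lambda>j. U_list k (3 ^ j * t)) [0..<m + 1])"

text \<open>The list of coordinates as a vector over a finite linearly ordered index type; the number of
  indices below \<open>i\<close> is the (zero-based) position of \<open>i\<close>. This is the curve
  into the \<open>2k(m+1)\<close>-dimensional Euclidean space only if the index type has exactly
  \<open>2k(m+1)\<close> elements.\<close>

definition Psi :: "nat \<Rightarrow> nat \<Rightarrow> real \<Rightarrow> real ^ 'n::{finite,linorder}" where
  "Psi k m t = (\<chi> i. Psi_list k m t ! card {j. j < i})"

lemma length_U_list: "length (U_list k t) = 2 * k"
  by (induction k) (auto simp: U_list_def)

lemma length_Psi_list: "length (Psi_list k m t) = 2 * k * (m + 1)"
  by (induction m) (auto simp: Psi_list_def length_U_list)

lemma U_list_periodic: "U_list k (t + 2 * pi * real n) = U_list k t"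
proof -
  have "real (2 * i + 1) * (t + 2 * pi * real n)
          = real (2 * i + 1) * t + 2 * pi * of_int (int ((2 * i + 1) * n))" for i
    by (simp add: algebra_simps)
  then show ?thesis
    unfolding U_list_def by (simp only: cos_add sin_add cos_int_2pin sin_int_2pin) simp
qed

lemma Psi_periodic: "Psi k m (t + 2 * pi) = Psi k m t"
proof -
  have "3 ^ j * (t + 2 * pi) = 3 ^ j * t + 2 * pi * real (3 ^ j)" for j :: nat
    by (simp add: algebra_simps)
  then show ?thesis
    by (simp only: Psi_def Psi_list_def U_list_periodic)
qed

definition P_poly :: "nat \<Rightarrow> nat \<Rightarrow> real set \<Rightarrow> (real ^ 'n::{finite,linorder}) set" where
  "P_poly k m V = convex hull (Psi k m ` V)"

definition vertices :: "'a::real_vector set \<Rightarrow> 'a set" where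
  "vertices P = {v. v extreme_point_of P}"

definition centrally_symmetric :: "'a::real_vector set \<Rightarrow> bool" where
  "centrally_symmetric P \<longleftrightarrow> P = uminus ` P"

definition k_neighborly :: "nat \<Rightarrow> 'a::euclidean_space set \<Rightarrow> bool" where
  "k_neighborly k P \<longleftrightarrow>
     (\<forall>S. S \<subseteq> vertices P \<and> finite S \<and> card S = k \<and> pairwise (\<lambda>v w. w \<noteq> - v) S
        \<longrightarrow> (\<exists>G. G face_of P \<and> vertices G = S \<and> aff_dim G = int k - 1))"

end

theory Submission
  imports Defs
begin

text \<open>A face of the polytope is exposed by a nonnegative function \<open>1 + h (3 ^ n * t)\<close>, where \<open>h\<close>
  is a trigonometric polynomial with odd frequencies below \<open>2 * k\<close>, so that \<open>h (t + \<pi>) = - h t\<close>.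

  Let \<open>Y\<close> be \<open>k\<close> points in an arc of length less than \<open>\<pi> / 2\<close>. Hermite interpolation gives \<open>h\<close>
  such that \<open>f = 1 + h\<close> has double zeros on \<open>Y\<close>. By Rolle, \<open>f'\<close> has \<open>2 * k - 1\<close> zeros \<open>r\<close> in the
  arc, hence \<open>f' t = C * (\<Prod>r. sin (t - r))\<close>, which fixes the sign of \<open>f'\<close>: \<open>f\<close> is positive
  between the points of \<open>Y\<close> and increases from 0 to 2 between the arc and its antipode. On the
  antipodal arc \<open>f (t + \<pi>) = 2 - f t\<close>, so \<open>f < 2\<close> on the arc is needed. Reflect the arc, with
  midpoint \<open>c\<close>, by \<open>t \<mapsto> 2 * c + \<pi> / 2 - t\<close>: each factor of \<open>f'\<close> grows in absolute value, so
  \<open>f t\<close> plus \<open>f\<close> at the reflected point is decreasing in \<open>t\<close>, which yields the bound.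

  Modulo \<open>2 * \<pi>\<close>, the point \<open>3 ^ n * t(I, a)\<close> lies in a fixed half-open arc of length \<open>\<pi> / 2\<close>
  starting at 0 or \<open>\<pi>\<close>, according to the parity of \<open>a + [n \<in> I]\<close>. By \<open>k\<close>-independence, a suitable
  \<open>n\<close> moves any \<open>k\<close> non-antipodal vertices into the same arc, where the perturbations keep them
  distinct.\<close>

section \<open>Forms in sine and cosine\<close>

text \<open>Homogeneous polynomials of degree \<open>n\<close> in \<open>sin t\<close> and \<open>cos t\<close>.\<close>

fun trig_form :: "nat \<Rightarrow> (real \<Rightarrow> real) \<Rightarrow> bool" where
  "trig_form 0 f \<longleftrightarrow> (\<exists>c. f = (\<lambda>t. c))"
| "trig_form (Suc n) f \<longleftrightarrow>
     (\<exists>g h. trig_form n g \<and> trig_form n h \<and> f = (\<lambda>t. sin t * g t + cos t * h t))"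

lemma trig_form_add:
  "trig_form n f \<Longrightarrow> trig_form n g \<Longrightarrow> trig_form n (\<lambda>t. f t + g t)"
proof (induction n arbitrary: f g)
  case 0
  then show ?case by auto
next
  case (Suc n)
  obtain f1 f2 where f: "trig_form n f1" "trig_form n f2" "f = (\<lambda>t. sin t * f1 t + cos t * f2 t)"
    using Suc.prems(1) by auto
  obtain g1 g2 where g: "trig_form n g1" "trig_form n g2" "g = (\<lambda>t. sin t * g1 t + cos t * g2 t)"
    using Suc.prems(2) by auto
  have "(\<lambda>t. f t + g t) = (\<lambda>t. sin t * (f1 t + g1 t) + cos t * (f2 t + g2 t))"
    by (auto simp: f g algebra_simps)
  then show ?case
    using Suc.IH[OF f(1) g(1)] Suc.IH[OF f(2) g(2)] by (auto simp del: fun_eq_iff)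
qed

lemma trig_form_scale:
  "trig_form n f \<Longrightarrow> trig_form n (\<lambda>t. c * f t)"
proof (induction n arbitrary: f)
  case 0
  then show ?case by auto
next
  case (Suc n)
  obtain f1 f2 where f: "trig_form n f1" "trig_form n f2" "f = (\<lambda>t. sin t * f1 t + cos t * f2 t)"
    using Suc.prems by auto
  have "(\<lambda>t. c * f t) = (\<lambda>t. sin t * (c * f1 t) + cos t * (c * f2 t))"
    by (auto simp: f algebra_simps)
  then show ?case
    using Suc.IH[OF f(1)] Suc.IH[OF f(2)] by auto
qed

lemma trig_form_zero: "trig_form n (\<lambda>t. 0)"
proof (induction n)
  case (Suc n)
  have "(\<lambda>t. 0) = (\<lambda>t. sin t * (0::real) + cos t * 0)" by auto
  then show ?case using Suc trig_form.simps(2) by blast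
qed auto

text \<open>A rotation by \<open>r\<close> maps the span of \<open>sin\<close> and
  \<open>cos\<close> to itself, so the recursion may be centred at any \<open>r\<close>. With the
  converse \<open>trig_form_SucE\<close>, the centre can be put at a root.\<close>

lemma trig_form_SucI:
  assumes "trig_form n g" "trig_form n h"
  shows "trig_form (Suc n) (\<lambda>t. sin (t - r) * g t + cos (t - r) * h t)"
proof -
  have "(\<lambda>t. sin (t - r) * g t + cos (t - r) * h t)
    = (\<lambda>t. sin t * (cos r * g t + sin r * h t) + cos t * (cos r * h t + (- sin r) * g t))"
    by (auto simp: sin_diff cos_diff algebra_simps)
  moreover have "trig_form n (\<lambda>t. cos r * g t + sin r * h t)"
    "trig_form n (\<lambda>t. cos r * h t + (- sin r) * g t)"
    by (intro trig_form_add trig_form_scale assms)+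
  ultimately show ?thesis by auto
qed

lemma trig_form_SucE:
  assumes "trig_form (Suc n) f"
  obtains g h where "trig_form n g" "trig_form n h"
    "f = (\<lambda>t. sin (t - r) * g t + cos (t - r) * h t)"
proof -
  obtain f1 f2 where f: "trig_form n f1" "trig_form n f2" "f = (\<lambda>t. sin t * f1 t + cos t * f2 t)"
    using assms by auto
  have s: "sin t = sin (t - r) * cos r + cos (t - r) * sin r" for t
    using sin_add[of "t - r" r] by simp
  have c: "cos t = cos (t - r) * cos r - sin (t - r) * sin r" for t
    using cos_add[of "t - r" r] by simp
  have "f t = sin (t - r) * (cos r * f1 t + (- sin r) * f2 t)
    + cos (t - r) * (sin r * f1 t + cos r * f2 t)" for t
    unfolding f(3) by (subst s, subst c) (simp add: algebra_simps)
  moreover have "trig_form n (\<lambda>t. cos r * f1 t + (- sin r) * f2 t)"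
    "trig_form n (\<lambda>t. sin r * f1 t + cos r * f2 t)"
    by (intro trig_form_add trig_form_scale f)+
  ultimately show ?thesis using that by blast
qed

lemma trig_form_sin: "trig_form n f \<Longrightarrow> trig_form (Suc n) (\<lambda>t. sin (t - r) * f t)"
  using trig_form_SucI[of n f "\<lambda>t. 0" r] trig_form_zero by simp

lemma trig_form_cos: "trig_form n f \<Longrightarrow> trig_form (Suc n) (\<lambda>t. cos (t - r) * f t)"
  using trig_form_SucI[of n "\<lambda>t. 0" f r] trig_form_zero by simp

text \<open>Multiplication by the sum of the squares of \<open>sin t\<close> and
  \<open>cos t\<close>, which is 1, raises the degree by 2.\<close>

lemma trig_form_raise: "trig_form n f \<Longrightarrow> trig_form (n + 2 * j) f"
proof (induction j)
  case (Suc j)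
  have "f = (\<lambda>t. sin t * (sin t * f t) + cos t * (cos t * f t))"
  proof
    fix t show "f t = sin t * (sin t * f t) + cos t * (cos t * f t)"
      using sin_cos_squared_add[of t] by algebra
  qed
  moreover have "trig_form (Suc (n + 2 * j)) (\<lambda>t. sin t * f t)"
    "trig_form (Suc (n + 2 * j)) (\<lambda>t. cos t * f t)"
    using trig_form_sin[of "n + 2 * j" f 0] trig_form_cos[of "n + 2 * j" f 0] Suc by auto
  ultimately have "trig_form (Suc (Suc (n + 2 * j))) f"
    using trig_form.simps(2) by blast
  then show ?case by simp
qed simp

lemma trig_form_add_pi: "trig_form n f \<Longrightarrow> f (t + pi) = (-1) ^ n * f t"
proof (induction n arbitrary: f)
  case (Suc n)
  then obtain g h where f: "trig_form n g" "trig_form n h" "f = (\<lambda>t. sin t * g t + cos t * h t)"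
    by auto
  show ?case using Suc.IH[OF f(1)] Suc.IH[OF f(2)] by (simp add: f(3) algebra_simps)
qed auto

lemma trig_form_deriv:
  "trig_form n f \<Longrightarrow> \<exists>f'. trig_form n f' \<and> (\<forall>t. (f has_real_derivative f' t) (at t))"
proof (induction n arbitrary: f)
  case 0
  then obtain c where "f = (\<lambda>t. c)" by auto
  then show ?case by (intro exI[of _ "\<lambda>t. 0"]) auto
next
  case (Suc n)
  then obtain g h where f: "trig_form n g" "trig_form n h" "f = (\<lambda>t. sin t * g t + cos t * h t)"
    by auto
  obtain g' where g': "trig_form n g'" "\<And>t. (g has_real_derivative g' t) (at t)"
    using Suc.IH[OF f(1)] by blast
  obtain h' where h': "trig_form n h'" "\<And>t. (h has_real_derivative h' t) (at t)"
    using Suc.IH[OF f(2)] by blast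
  let ?f' = "\<lambda>t. sin t * (g' t + (-1) * h t) + cos t * (h' t + g t)"
  have "trig_form n (\<lambda>t. g' t + (-1) * h t)" "trig_form n (\<lambda>t. h' t + g t)"
    by (intro trig_form_add trig_form_scale f g' h')+
  then have "trig_form (Suc n) ?f'" by auto
  moreover have "(f has_real_derivative ?f' t) (at t)" for t
    unfolding f(3) by (auto intro!: derivative_eq_intros g'(2) h'(2) simp: algebra_simps)
  ultimately show ?case by blast
qed

section \<open>Roots and factorization\<close>

text \<open>In the expansion centred at \<open>r\<close> only the cosine term survives at
  \<open>r\<close>, so its coefficient \<open>h\<close> vanishes there and the induction divides
  \<open>h\<close> by the same sine. As \<open>n - 1\<close> is truncated, the extra clause records
  that in degree 0 the quotient is zero.\<close>

lemma trig_form_root: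
  "trig_form n f \<Longrightarrow> f r = 0 \<Longrightarrow>
    \<exists>g. trig_form (n - 1) g \<and> (n = 0 \<longrightarrow> g = (\<lambda>t. 0)) \<and> f = (\<lambda>t. sin (t - r) * g t)"
proof (induction n arbitrary: f)
  case 0
  then show ?case by (intro exI[of _ "\<lambda>t. 0"]) auto
next
  case (Suc n)
  obtain g h where f: "trig_form n g" "trig_form n h"
    "f = (\<lambda>t. sin (t - r) * g t + cos (t - r) * h t)"
    using Suc.prems(1) by (rule trig_form_SucE)
  have "h r = 0" using Suc.prems(2) f(3) by simp
  from Suc.IH[OF f(2) this] obtain q where q: "trig_form (n - 1) q" "n = 0 \<longrightarrow> q = (\<lambda>t. 0)"
    "h = (\<lambda>t. sin (t - r) * q t)" by blast
  have "trig_form n (\<lambda>t. cos (t - r) * q t)"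
  proof (cases n)
    case 0
    then show ?thesis using q by auto
  next
    case (Suc l)
    then show ?thesis using trig_form_cos[of l q r] q by simp
  qed
  from trig_form_add[OF f(1) this]
  have "trig_form n (\<lambda>t. g t + cos (t - r) * q t)" .
  moreover have "f = (\<lambda>t. sin (t - r) * (g t + cos (t - r) * q t))"
    by (auto simp: f(3) q(3) algebra_simps)
  ultimately show ?case by auto
qed

lemma sin_nonzero_abs: "x \<noteq> 0 \<Longrightarrow> \<bar>x\<bar> < pi \<Longrightarrow> sin x \<noteq> (0::real)"
  using sin_gt_zero[of x] sin_gt_zero[of "-x"] by (cases "x > 0") auto

text \<open>The roots are split off one after another: two of them differ by less than
  \<open>pi\<close>, so the sine already removed is nonzero at the remaining roots. As many roots as
  the degree leave a constant quotient.\<close>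

lemma trig_form_factor:
  assumes "finite R" "trig_form (card R) f" "\<And>r. r \<in> R \<Longrightarrow> f r = 0"
    "\<And>r s. r \<in> R \<Longrightarrow> s \<in> R \<Longrightarrow> \<bar>r - s\<bar> < pi"
  shows "\<exists>C. \<forall>t. f t = C * (\<Prod>r\<in>R. sin (t - r))"
  using assms
proof (induction R arbitrary: f rule: finite_induct)
  case empty
  then show ?case by auto
next
  case (insert x R)
  have "card (insert x R) = Suc (card R)" using insert by simp
  then obtain g where g: "trig_form (card R) g" "f = (\<lambda>t. sin (t - x) * g t)"
    using trig_form_root[OF insert.prems(1), of x] insert.prems(2) by auto
  have "g r = 0" if "r \<in> R" for r
  proof -
    have "sin (r - x) \<noteq> 0"
      using insert that by (intro sin_nonzero_abs) auto
    then show ?thesis using insert.prems(2)[of r] that g by auto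
  qed
  from insert.IH[OF g(1) this] insert.prems(3)
  obtain C where "\<forall>t. g t = C * (\<Prod>r\<in>R. sin (t - r))" by auto
  then show ?case using insert.hyps by (intro exI[of _ C]) (auto simp: g(2))
qed

lemma trig_form_prod_sin:
  "finite Y \<Longrightarrow> trig_form (2 * card Y) (\<lambda>t. \<Prod>y\<in>Y. (sin (t - y))\<^sup>2)"
proof (induction Y rule: finite_induct)
  case (insert x Y)
  have "trig_form (Suc (Suc (2 * card Y))) (\<lambda>t. sin (t - x) * (sin (t - x) * (\<Prod>y\<in>Y. (sin (t - y))\<^sup>2)))"
    by (intro trig_form_sin insert.IH)
  then show ?case using insert.hyps by (simp add: power2_eq_square mult.assoc)
qed auto

section \<open>Hermite interpolation\<close>

text \<open>Newton-style induction on the nodes: \<open>p\<close> has double zeros on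
  \<open>Y\<close>, so adding \<open>p\<close> times a linear form in sine and cosine keeps the old
  conditions, and its two coefficients meet the two conditions at the new node
  \<open>x\<close>.\<close>

lemma trig_hermite:
  assumes "finite Y" "Y \<noteq> {}" "\<And>r s. r \<in> Y \<Longrightarrow> s \<in> Y \<Longrightarrow> \<bar>r - s\<bar> < pi"
  shows "\<exists>h. trig_form (2 * card Y - 1) h \<and>
    (\<forall>y\<in>Y. h y = -1 \<and> (h has_real_derivative 0) (at y))"
  using assms
proof (induction Y rule: finite_ne_induct)
  case (singleton x)
  have "trig_form (Suc 0) (\<lambda>t. cos (t - x) * (-1))"
    by (intro trig_form_cos) auto
  moreover have "((\<lambda>t. cos (t - x) * (-1)) has_real_derivative 0) (at x)"
    by (auto intro!: derivative_eq_intros)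
  ultimately show ?case by (intro exI[of _ "\<lambda>t. cos (t - x) * (-1)"]) simp
next
  case (insert x Y)
  then obtain h where h: "trig_form (2 * card Y - 1) h"
    "\<And>y. y \<in> Y \<Longrightarrow> h y = -1" "\<And>y. y \<in> Y \<Longrightarrow> (h has_real_derivative 0) (at y)" by auto
  define p where "p = (\<lambda>t. \<Prod>y\<in>Y. (sin (t - y))\<^sup>2)"
  have p: "trig_form (2 * card Y) p"
    unfolding p_def by (rule trig_form_prod_sin) fact
  obtain p' where p': "\<And>t. (p has_real_derivative p' t) (at t)"
    using trig_form_deriv[OF p] by blast
  obtain h' where h': "\<And>t. (h has_real_derivative h' t) (at t)"
    using trig_form_deriv[OF h(1)] by blast
  have p0: "p y = 0" if "y \<in> Y" for y
    unfolding p_def using that insert.hyps by (intro prod_zero bexI[of _ y]) auto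
  have p'0: "p' y = 0" if "y \<in> Y" for y
  proof -
    have "p = (\<lambda>t. (sin (t - y))\<^sup>2 * (\<Prod>z\<in>Y - {y}. (sin (t - z))\<^sup>2))"
      unfolding p_def using prod.remove[OF insert.hyps(1) that] by auto
    moreover obtain q' where
      "((\<lambda>t. \<Prod>z\<in>Y - {y}. (sin (t - z))\<^sup>2) has_real_derivative q') (at y)"
      using trig_form_deriv[OF trig_form_prod_sin[of "Y - {y}"]] insert.hyps by blast
    ultimately have "(p has_real_derivative 0) (at y)"
      by (auto intro!: derivative_eq_intros)
    then show ?thesis using p' DERIV_unique by blast
  qed
  have px: "p x \<noteq> 0"
  proof -
    have "sin (x - y) \<noteq> 0" if "y \<in> Y" for y
      using insert.hyps insert.prems that by (intro sin_nonzero_abs) auto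
    then show ?thesis unfolding p_def using insert.hyps by auto
  qed
  \<comment> \<open>\<open>a\<close> is forced by the value of \<open>g\<close> at \<open>x\<close>,
    and then \<open>b\<close> by its derivative there, since at \<open>x\<close> the sine is 0 and
    the cosine is 1.\<close>
  define a where "a = (-1 - h x) / p x"
  define b where "b = (- h' x - a * p' x) / p x"
  define g where "g = (\<lambda>t. h t + (sin (t - x) * (b * p t) + cos (t - x) * (a * p t)))"
  have "card (insert x Y) = Suc (card Y)" "card Y > 0" using insert by (auto simp: card_gt_0_iff)
  then have n: "2 * card (insert x Y) - 1 = Suc (2 * card Y)"
    "Suc (2 * card Y) = (2 * card Y - 1) + 2 * 1" by auto
  have "trig_form (Suc (2 * card Y)) h" unfolding n(2) by (rule trig_form_raise[OF h(1)])
  then have "trig_form (2 * card (insert x Y) - 1) g"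
    unfolding n(1) g_def by (intro trig_form_add trig_form_SucI trig_form_scale p)
  moreover have gd: "(g has_real_derivative (h' t + (cos (t - x) * (b * p t) + sin (t - x) * (b * p' t)
      - sin (t - x) * (a * p t) + cos (t - x) * (a * p' t)))) (at t)" for t
    unfolding g_def by (auto intro!: derivative_eq_intros p' h')
  have "g x = -1" "h' x + b * p x + a * p' x = 0"
    using px by (auto simp: g_def a_def b_def)
  moreover have "(g has_real_derivative 0) (at x)"
    using gd[of x] calculation by (simp add: algebra_simps)
  moreover have "g y = -1" "(g has_real_derivative 0) (at y)" if "y \<in> Y" for y
  proof -
    show "g y = -1" using h(2) p0 that by (simp add: g_def)
    have "h' y = 0" using h' h(3) that DERIV_unique by blast
    then show "(g has_real_derivative 0) (at y)" using gd[of y] p0 p'0 that by simp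
  qed
  ultimately show ?case by (intro exI[of _ g]) auto
qed

section \<open>Fourier sums\<close>

text \<open>The frequencies are at most \<open>n\<close> and have the parity of \<open>n\<close>;
  for \<open>n = 2 * k - 1\<close> with positive \<open>k\<close> they are those of
  \<open>U_list k\<close>. A frequency may be added repeatedly.\<close>

inductive trig_sum :: "nat \<Rightarrow> (real \<Rightarrow> real) \<Rightarrow> bool" for n where
  zero: "trig_sum n (\<lambda>t. 0)"
| add_term: "j \<le> n \<Longrightarrow> even (n + j) \<Longrightarrow> trig_sum n f \<Longrightarrow>
    trig_sum n (\<lambda>t. (a * cos (real j * t) + b * sin (real j * t)) + f t)"

lemma trig_sum_add: "trig_sum n f \<Longrightarrow> trig_sum n g \<Longrightarrow> trig_sum n (\<lambda>t. f t + g t)"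
proof (induction rule: trig_sum.induct)
  case (add_term j f a b)
  then have "trig_sum n (\<lambda>t. (a * cos (real j * t) + b * sin (real j * t)) + (f t + g t))"
    by (intro trig_sum.add_term) auto
  then show ?case by (simp add: add.assoc)
qed simp

lemma trig_sum_term:
  "j \<le> n \<Longrightarrow> even (n + j) \<Longrightarrow> trig_sum n (\<lambda>t. a * cos (real j * t) + b * sin (real j * t))"
  using trig_sum.add_term[OF _ _ trig_sum.zero, of j n a b] by simp

text \<open>The product-to-sum formulas send frequency \<open>j\<close> to \<open>j + 1\<close> and
  \<open>j - 1\<close>, both of the parity of \<open>n + 1\<close>; a constant only produces
  frequency 1.\<close>

lemma trig_sum_sin_cos:
  assumes "trig_sum n f"
  shows "trig_sum (Suc n) (\<lambda>t. sin t * f t)" "trig_sum (Suc n) (\<lambda>t. cos t * f t)"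
proof -
  have "trig_sum (Suc n) (\<lambda>t. sin t * f t) \<and> trig_sum (Suc n) (\<lambda>t. cos t * f t)"
    using assms
  proof (induction rule: trig_sum.induct)
    case zero
    then show ?case by (simp add: trig_sum.zero)
  next
    case (add_term j f a b)
    let ?g = "\<lambda>t. a * cos (real j * t) + b * sin (real j * t)"
    have "trig_sum (Suc n) (\<lambda>t. sin t * ?g t) \<and> trig_sum (Suc n) (\<lambda>t. cos t * ?g t)"
    proof (cases j)
      case 0
      have "trig_sum (Suc n) (\<lambda>t. 0 * cos (real 1 * t) + a * sin (real 1 * t))"
        "trig_sum (Suc n) (\<lambda>t. a * cos (real 1 * t) + 0 * sin (real 1 * t))"
        using add_term 0 by (intro trig_sum_term; simp)+
      then show ?thesis using 0 by (simp add: mult.commute)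
    next
      case (Suc i)
      have 1: "trig_sum (Suc n) (\<lambda>t. c * cos (real (Suc j) * t) + d * sin (real (Suc j) * t))"
        and 2: "trig_sum (Suc n) (\<lambda>t. c * cos (real i * t) + d * sin (real i * t))" for c d
        using add_term Suc by (intro trig_sum_term; simp)+
      have p: "cos (real (Suc j) * t) = cos (real j * t) * cos t - sin (real j * t) * sin t"
        "sin (real (Suc j) * t) = sin (real j * t) * cos t + cos (real j * t) * sin t" for t
        by (simp_all add: distrib_right cos_add sin_add)
      have q: "cos (real i * t) = cos (real j * t) * cos t + sin (real j * t) * sin t"
        "sin (real i * t) = sin (real j * t) * cos t - cos (real j * t) * sin t" for t
        using cos_diff[of "real j * t" t] sin_diff[of "real j * t" t]
        by (simp_all add: Suc distrib_right)
      have "sin t * ?g t = (- (b / 2) * cos (real (Suc j) * t) + a / 2 * sin (real (Suc j) * t))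
          + (b / 2 * cos (real i * t) + - (a / 2) * sin (real i * t))" for t
        unfolding p q by (simp add: algebra_simps)
      moreover have "cos t * ?g t = (a / 2 * cos (real (Suc j) * t) + b / 2 * sin (real (Suc j) * t))
          + (a / 2 * cos (real i * t) + b / 2 * sin (real i * t))" for t
        unfolding p q by (simp add: algebra_simps)
      ultimately show ?thesis
        using trig_sum_add[OF 1[of "- (b / 2)" "a / 2"] 2[of "b / 2" "- (a / 2)"]]
          trig_sum_add[OF 1[of "a / 2" "b / 2"] 2[of "a / 2" "b / 2"]] by presburger
    qed
    then show ?case
      using add_term.IH trig_sum_add[of "Suc n" "\<lambda>t. sin t * ?g t" "\<lambda>t. sin t * f t"]
        trig_sum_add[of "Suc n" "\<lambda>t. cos t * ?g t" "\<lambda>t. cos t * f t"]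
      by (simp add: distrib_left)
  qed
  then show "trig_sum (Suc n) (\<lambda>t. sin t * f t)" "trig_sum (Suc n) (\<lambda>t. cos t * f t)" by auto
qed

lemma trig_form_imp_trig_sum: "trig_form n f \<Longrightarrow> trig_sum n f"
proof (induction n arbitrary: f)
  case 0
  then obtain c where "f = (\<lambda>t. c)" by auto
  then show ?case using trig_sum_term[of 0 0 c 0] by simp
next
  case (Suc n)
  then obtain g h where "trig_form n g" "trig_form n h" "f = (\<lambda>t. sin t * g t + cos t * h t)"
    by auto
  then show ?case
    using trig_sum_add[OF trig_sum_sin_cos(1)[of n g] trig_sum_sin_cos(2)[of n h]] Suc.IH by simp
qed

section \<open>Nonnegative trigonometric polynomials with prescribed double zeros\<close>

text \<open>Rolle's theorem gives a zero of \<open>f'\<close> strictly inside each gap of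
  \<open>Y\<close>, in addition to the zeros on \<open>Y\<close>. The induction adds a new largest
  node \<open>b\<close> together with the zero \<open>z\<close> of the last gap. Zeros thus arrive
  in pairs, whence the parity in the last clause, from which the sign of \<open>f'\<close> on either
  side of \<open>z\<close> is read off later.\<close>

lemma rolle_double_roots:
  fixes f f' :: "real \<Rightarrow> real"
  assumes "finite Y" "Y \<noteq> {}"
    and f': "\<And>t. (f has_real_derivative f' t) (at t)"
    and "\<forall>y\<in>Y. f y = 0 \<and> f' y = 0"
  shows "\<exists>R. finite R \<and> Y \<subseteq> R \<and> card R = 2 * card Y - 1 \<and> R \<subseteq> {Min Y..Max Y} \<and>
    (\<forall>r\<in>R. f' r = 0) \<and>
    (\<forall>x. Min Y \<le> x \<and> x \<le> Max Y \<and> x \<notin> Y \<longrightarrow>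
      (\<exists>a\<in>Y. \<exists>b\<in>Y. \<exists>z. a < x \<and> x < b \<and> a < z \<and> z < b \<and> R \<inter> {a..b} = {a, z, b}
        \<and> even (card {r \<in> R. a < r})))"
  using assms(1,2,4)
proof (induction Y rule: finite_linorder_max_induct)
  case (insert b Y)
  show ?case
  proof (cases "Y = {}")
    case True
    then show ?thesis using insert.prems by (intro exI[of _ "{b}"]) auto
  next
    case False
    define m where "m = Max Y"
    have m: "m \<in> Y" "m < b" "\<And>y. y \<in> Y \<Longrightarrow> y \<le> m"
      using insert.hyps False by (auto simp: m_def)
    have "\<forall>y\<in>Y. f y = 0 \<and> f' y = 0"
      using insert.prems by auto
    from insert.IH[OF False this] obtain R where R: "finite R" "Y \<subseteq> R"
      "card R = 2 * card Y - 1" "R \<subseteq> {Min Y..m}" "\<forall>r\<in>R. f' r = 0"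
      and gap: "\<forall>x. Min Y \<le> x \<and> x \<le> m \<and> x \<notin> Y \<longrightarrow>
      (\<exists>a\<in>Y. \<exists>b\<in>Y. \<exists>z. a < x \<and> x < b \<and> a < z \<and> z < b \<and> R \<inter> {a..b} = {a, z, b}
        \<and> even (card {r \<in> R. a < r}))"
      unfolding m_def[symmetric] by (elim exE conjE) (rule that, assumption+)
    have cont: "continuous_on {m..b} f"
      using f' by (intro continuous_at_imp_continuous_on) (auto intro: DERIV_isCont)
    obtain z where z: "m < z" "z < b" "f' z = 0"
    proof -
      have "f m = f b" using insert.prems m by simp
      moreover have "\<And>x. f differentiable (at x)"
        using f' real_differentiable_def by blast
      ultimately obtain z where "m < z" "z < b" "DERIV f z :> 0"
        using Rolle[of m b f] m(2) cont by blast
      then show ?thesis using that DERIV_unique f' by blast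
    qed
    have Rm: "r \<le> m" if "r \<in> R" for r using R(4) that by auto
    have new: "z \<notin> R" "b \<notin> R" "z \<noteq> b" using Rm[of z] Rm[of b] z m by auto
    have Mi: "Min (insert b Y) = Min Y"
    proof -
      have "Min Y \<le> m" using m insert.hyps by auto
      then show ?thesis using Min_insert[OF insert.hyps(1) False, of b] m(2) by simp
    qed
    have Ma: "Max (insert b Y) = b"
      using insert.hyps False m by (auto simp: max_def m_def[symmetric])
    let ?R = "insert z (insert b R)"
    have "card (insert b Y) = Suc (card Y)" "card Y > 0"
      using insert.hyps False by (auto simp: card_gt_0_iff)
    then have "card ?R = 2 * card (insert b Y) - 1"
      using R(1,3) new by simp
    moreover have "Min Y \<le> m" using m insert.hyps by auto
    then have "?R \<subseteq> {Min Y..b}" using R(4) z m by auto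
    moreover have "\<exists>a\<in>insert b Y. \<exists>b'\<in>insert b Y. \<exists>z'. a < x \<and> x < b' \<and> a < z' \<and> z' < b' \<and>
        ?R \<inter> {a..b'} = {a, z', b'} \<and> even (card {r \<in> ?R. a < r})"
      if x: "Min Y \<le> x" "x \<le> b" "x \<notin> insert b Y" for x
    proof (cases "x \<le> m")
      case True
      then have "Min Y \<le> x \<and> x \<le> m \<and> x \<notin> Y" using x by simp
      with gap obtain a b' z' where a: "a \<in> Y" "b' \<in> Y" "a < x" "x < b'" "a < z'" "z' < b'"
        "R \<inter> {a..b'} = {a, z', b'}" "even (card {r \<in> R. a < r})" by blast
      have "a < z" "a < b" using m(3)[OF a(1)] z by auto
      then have "{r \<in> ?R. a < r} = insert z (insert b {r \<in> R. a < r})" by auto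
      then have "even (card {r \<in> ?R. a < r})"
        using R(1) new a(8) by simp
      moreover have "?R \<inter> {a..b'} = {a, z', b'}"
        using a(7) m(3)[OF a(2)] z by auto
      ultimately show ?thesis using a by blast
    next
      case False
      have "?R \<inter> {m..b} = {m, z, b}" using m R(2) Rm z by (auto intro: antisym)
      moreover have "{r \<in> ?R. m < r} = {z, b}" using Rm m z by (auto simp: leD)
      ultimately show ?thesis using False x m z new(3)
        by (intro bexI[of _ m] bexI[of _ b] exI[of _ z]) auto
    qed
    ultimately show ?thesis
      unfolding Mi Ma using R z insert.prems m
      by (intro exI[of _ ?R]) (auto simp del: Int_insert_left Int_insert_right)
  qed
qed simp

lemma prod_sin_sign:
  fixes t :: real
  assumes "finite R" "t \<notin> R" "\<And>r. r \<in> R \<Longrightarrow> \<bar>t - r\<bar> < pi"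
  shows "0 < (-1) ^ card {r \<in> R. t < r} * (\<Prod>r\<in>R. sin (t - r))"
  using assms
proof (induction R rule: finite_induct)
  case (insert x R)
  then have IH: "0 < (-1) ^ card {r \<in> R. t < r} * (\<Prod>r\<in>R. sin (t - r))" by auto
  show ?case
  proof (cases "t < x")
    case True
    then have "{r \<in> insert x R. t < r} = insert x {r \<in> R. t < r}" by auto
    moreover have "sin (x - t) > 0" using True insert.prems(2)[of x] by (intro sin_gt_zero) auto
    then have "sin (t - x) < 0" using sin_minus[of "x - t"] by simp
    ultimately show ?thesis using insert.hyps IH by (auto simp: mult_less_0_iff zero_less_mult_iff)
  next
    case False
    then have "{r \<in> insert x R. t < r} = {r \<in> R. t < r}" by auto
    moreover have "sin (t - x) > 0"
      using False insert.prems(1) insert.prems(2)[of x] by (intro sin_gt_zero) auto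
    ultimately show ?thesis using insert.hyps IH by (auto simp: mult_less_0_iff zero_less_mult_iff)
  qed
qed simp

text \<open>Exact knowledge of the zeros modulo \<open>2 * pi\<close> is what later decides which
  vertices lie on a supporting hyperplane. The radius \<open>pi / 4\<close> makes the reflection
  bound \<open>upper\<close> work.\<close>

lemma trig_form_supporting:
  assumes Y: "finite Y" "Y \<noteq> {}" and c: "\<And>y. y \<in> Y \<Longrightarrow> \<bar>y - c\<bar> < pi / 4"
  shows "\<exists>h. trig_form (2 * card Y - 1) h \<and> (\<forall>t. 0 \<le> 1 + h t) \<and>
    (\<forall>t. 1 + h t = 0 \<longleftrightarrow> (\<exists>y\<in>Y. \<exists>l::int. t = y + 2 * pi * l))"
proof -
  let ?n = "2 * card Y - 1"
  have close: "\<bar>r - s\<bar> < pi" if "r \<in> Y" "s \<in> Y" for r s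
    using c[OF that(1)] c[OF that(2)] pi_gt_zero by linarith
  obtain h where h: "trig_form ?n h" "\<And>y. y \<in> Y \<Longrightarrow> h y = -1"
    "\<And>y. y \<in> Y \<Longrightarrow> (h has_real_derivative 0) (at y)"
    using trig_hermite[OF Y close] by blast
  obtain h' where h': "trig_form ?n h'" "\<And>t. (h has_real_derivative h' t) (at t)"
    using trig_form_deriv[OF h(1)] by blast
  define f where "f = (\<lambda>t. 1 + h t)"
  have f': "(f has_real_derivative h' t) (at t)" for t
    unfolding f_def by (auto intro!: derivative_eq_intros h'(2))
  have fY: "f y = 0" "h' y = 0" if "y \<in> Y" for y
    using h(2)[OF that] DERIV_unique[OF h'(2) h(3)[OF that]] by (auto simp: f_def)
  define p where "p = Min Y"
  define q where "q = Max Y"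
  have pq: "p \<in> Y" "q \<in> Y" "p \<le> q" using Y by (auto simp: p_def q_def)
  have pc: "\<bar>p - c\<bar> < pi / 4" "\<bar>q - c\<bar> < pi / 4" using c pq by auto
  obtain R where R: "finite R" "Y \<subseteq> R" "card R = ?n" "R \<subseteq> {p..q}" "\<forall>r\<in>R. h' r = 0"
    and gap: "\<forall>x. p \<le> x \<and> x \<le> q \<and> x \<notin> Y \<longrightarrow>
      (\<exists>a\<in>Y. \<exists>b\<in>Y. \<exists>z. a < x \<and> x < b \<and> a < z \<and> z < b \<and> R \<inter> {a..b} = {a, z, b}
        \<and> even (card {r \<in> R. a < r}))"
  proof -
    have "\<forall>y\<in>Y. f y = 0 \<and> h' y = 0" using fY by blast
    from rolle_double_roots[OF Y f' this] show thesis
      unfolding p_def[symmetric] q_def[symmetric]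
      by (elim exE conjE) (rule that, assumption+)
  qed
  have Rpq: "p \<le> r" "r \<le> q" if "r \<in> R" for r using R(4) that by auto
  have Rc: "\<bar>r - c\<bar> < pi / 4" if "r \<in> R" for r using Rpq[OF that] pc by linarith
  obtain C where C: "\<And>t. h' t = C * (\<Prod>r\<in>R. sin (t - r))"
  proof -
    have "\<bar>r - s\<bar> < pi" if "r \<in> R" "s \<in> R" for r s
      using Rc[OF that(1)] Rc[OF that(2)] pi_gt_zero by linarith
    with h'(1) R(1,3,5) have "\<exists>C. \<forall>t. h' t = C * (\<Prod>r\<in>R. sin (t - r))"
      by (intro trig_form_factor) auto
    then show ?thesis using that by blast
  qed
  \<comment> \<open>Odd degree enters here: the shift by \<open>pi\<close> changes the sign of
    \<open>h\<close>, so \<open>f\<close> takes the value 2 opposite its zeros.\<close>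
  have odd: "odd ?n" using Y by (cases "card Y") auto
  have half: "f (t + pi) = 2 - f t" for t
    using trig_form_add_pi[OF h(1), of t] odd by (simp add: f_def)
  have fp: "f p = 0" "f q = 0" using fY pq by auto
  have cont: "continuous_on {a..b} f" for a b
    using f' by (intro continuous_at_imp_continuous_on) (auto intro: DERIV_isCont)
  have pos0: "0 < (\<Prod>r\<in>R. sin (t - r))" if "q < t" "t < p + pi" for t
  proof (rule prod_pos)
    fix r assume "r \<in> R"
    then show "0 < sin (t - r)" using that Rpq[of r] by (intro sin_gt_zero) auto
  qed
  \<comment> \<open>\<open>f\<close> rises from 0 at \<open>q\<close> to 2 at \<open>p + pi\<close>,
    so \<open>h'\<close> is positive at some point between, where the product is positive by
    \<open>pos0\<close>.\<close>
  have "C > 0"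
  proof -
    have "q < p + pi" using pc pi_gt_zero by linarith
    then obtain t where t: "q < t" "t < p + pi" "f (p + pi) - f q = (p + pi - q) * h' t"
      using MVT2[of q "p + pi" f h'] f' by auto
    then have "0 < (p + pi - q) * h' t" using half[of p] fp by simp
    moreover have "0 < p + pi - q" using t by simp
    ultimately have "0 < C * (\<Prod>r\<in>R. sin (t - r))" using C[of t] by (simp add: zero_less_mult_iff)
    then show ?thesis using pos0[OF t(1,2)] by (simp add: zero_less_mult_iff)
  qed
  have inc: "f s < f t" if "q \<le> s" "s < t" "t \<le> p + pi" for s t
  proof (rule DERIV_pos_imp_increasing_open[OF that(2) _ cont])
    fix x assume "s < x" "x < t"
    then have "h' x > 0" unfolding C using pos0[of x] \<open>C > 0\<close> that by simp
    then show "\<exists>y. (f has_real_derivative y) (at x) \<and> 0 < y" using f' by blast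
  qed
  have sgn: "0 < (-1) ^ card {r \<in> R. t < r} * h' t" if "p \<le> t" "t \<le> q" "t \<notin> R" for t
  proof -
    have "\<bar>t - r\<bar> < pi" if "r \<in> R" for r
      using Rpq[OF that] \<open>p \<le> t\<close> \<open>t \<le> q\<close> pc pi_gt_zero by linarith
    from prod_sin_sign[OF R(1) that(3) this]
    show ?thesis unfolding C using \<open>C > 0\<close> by (simp add: mult.left_commute[of _ C])
  qed
  \<comment> \<open>From \<open>a\<close> to \<open>z\<close> an even number of roots lies ahead and
    \<open>f\<close> climbs from 0; from \<open>z\<close> to \<open>b\<close> the number is odd and
    \<open>f\<close> descends to 0.\<close>
  have inner: "0 < f x" if "p \<le> x" "x \<le> q" "x \<notin> Y" for x
  proof -
    have "p \<le> x \<and> x \<le> q \<and> x \<notin> Y" using that by simp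
    with gap obtain a b z where abz: "a \<in> Y" "b \<in> Y" "a < x" "x < b" "a < z" "z < b"
      "R \<inter> {a..b} = {a, z, b}" "even (card {r \<in> R. a < r})"  by blast
    have ab: "p \<le> a" "b \<le> q" using Y abz by (auto simp: p_def q_def)
    have mem: "t \<in> R \<longleftrightarrow> t = z" if "a < t" "t < b" for t
    proof -
      have "t \<in> R \<longleftrightarrow> t \<in> R \<inter> {a..b}" using that by auto
      then show ?thesis unfolding abz(7) using that by auto
    qed
    show ?thesis
    proof (cases "x \<le> z")
      case True
      have "f a < f x"
      proof (rule DERIV_pos_imp_increasing_open[OF \<open>a < x\<close> _ cont])
        fix t assume t: "a < t" "t < x"
        have "{r \<in> R. t < r} = {r \<in> R. a < r}"
        proof (intro Collect_cong conj_cong refl iffI)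
          fix r assume "r \<in> R" "a < r"
          then show "t < r" using mem[of r] t True abz by force
        qed (use t in auto)
        moreover have "t \<notin> R" using mem[of t] t True abz by auto
        ultimately have "0 < h' t" using sgn[of t] t abz ab by (simp add: minus_one_power_iff)
        then show "\<exists>y. (f has_real_derivative y) (at t) \<and> 0 < y" using f' by blast
      qed
      then show ?thesis using fY abz by simp
    next
      case False
      have "f b < f x"
      proof (rule DERIV_neg_imp_decreasing_open[OF \<open>x < b\<close> _ cont])
        fix t assume t: "x < t" "t < b"
        have "{r \<in> R. a < r} = insert z {r \<in> R. t < r}"
        proof (intro set_eqI iffI)
          fix r assume "r \<in> {r \<in> R. a < r}"
          then show "r \<in> insert z {r \<in> R. t < r}" using mem[of r] t by force
        next
          fix r assume "r \<in> insert z {r \<in> R. t < r}"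
          then show "r \<in> {r \<in> R. a < r}" using mem[of z] t abz by auto
        qed
        moreover have "z \<notin> {r \<in> R. t < r}" using t False by auto
        ultimately have "odd (card {r \<in> R. t < r})" using abz(8) R(1) by simp
        moreover have "t \<notin> R" using mem[of t] t False abz by auto
        ultimately have "h' t < 0" using sgn[of t] t abz ab by (simp add: minus_one_power_iff)
        then show "\<exists>y. (f has_real_derivative y) (at t) \<and> y < 0" using f' by blast
      qed
      then show ?thesis using fY abz by simp
    qed
  qed
  have upper: "f t < 2" if t: "p \<le> t" "t \<le> q" for t
  proof -
    define g where "g = (\<lambda>t. f t + f (2 * c + pi / 2 - t))"
    have g': "(g has_real_derivative (h' t - h' (2 * c + pi / 2 - t))) (at t)" for t
      unfolding g_def by (auto intro!: derivative_eq_intros DERIV_chain2[OF f'] f')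
    have "h' x < h' (2 * c + pi / 2 - x)" if x: "p \<le> x" "x \<le> q" for x
    proof -
      have xc: "\<bar>x - c\<bar> < pi / 4" using x pc by linarith
      \<comment> \<open>with \<open>u = x - c\<close> and \<open>v = r - c\<close>: \<open>cos\<^sup>2 (u + v) - sin\<^sup>2 (u - v) = cos (2 u) cos (2 v) > 0\<close>\<close>
      have "\<bar>sin (x - r)\<bar> < sin (2 * c + pi / 2 - x - r)" if "r \<in> R" for r
      proof -
        have rc: "\<bar>r - c\<bar> < pi / 4" by (rule Rc[OF that])
        define u v where "u = x - c" and "v = r - c"
        have "x - r = u - v" by (auto simp: u_def v_def)
        moreover have uv: "- (pi / 4) < u" "u < pi / 4" "- (pi / 4) < v" "v < pi / 4"
          using xc rc unfolding u_def v_def by linarith+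
        then have "0 < cos (u + v)" by (auto intro!: cos_gt_zero_pi)
        moreover have "(cos (u + v))\<^sup>2 - (sin (u - v))\<^sup>2 = cos (2 * u) * cos (2 * v)"
          unfolding cos_add sin_diff cos_double by (simp add: power2_eq_square algebra_simps)
        moreover have "sin (2 * c + pi / 2 - x - r) = cos (u + v)"
          unfolding cos_sin_eq by (rule arg_cong[where f = sin]) (simp add: u_def v_def)
        moreover have "0 < cos (2 * u) * cos (2 * v)" using uv by (intro mult_pos_pos cos_gt_zero_pi) auto
        ultimately have "(sin (x - r))\<^sup>2 < (sin (2 * c + pi / 2 - x - r))\<^sup>2"
          "0 < sin (2 * c + pi / 2 - x - r)" by simp_all
        then show ?thesis
          using power_less_imp_less_base[of "\<bar>sin (x - r)\<bar>" 2] by simp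
      qed
      then have "\<bar>\<Prod>r\<in>R. sin (x - r)\<bar> < (\<Prod>r\<in>R. sin (2 * c + pi / 2 - x - r))"
        unfolding abs_prod using R(1,2) pq(1)
        by (intro prod_mono_strict[of p]) (fastforce intro: less_imp_le le_less_trans[OF abs_ge_zero])+
      then show ?thesis unfolding C using \<open>C > 0\<close> by (auto intro!: mult_strict_left_mono)
    qed
    then have "g t \<le> g p"
      using t g' by (intro DERIV_nonpos_imp_nonincreasing[of p t g]) (force intro: less_imp_le)+
    moreover have pb: "c - pi / 4 < p" "p < c + pi / 4" "c - pi / 4 < q" "q < c + pi / 4"
      using pc by linarith+
    \<comment> \<open>The reflected point of \<open>t\<close> lies beyond \<open>q\<close>, so the
      second summand of \<open>g t\<close> is positive; that of \<open>p\<close> lies before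
      \<open>p + pi\<close>, so \<open>g p < 2\<close>. With \<open>g t \<le> g p\<close> the bound
      follows.\<close>
    have "f q < f (2 * c + pi / 2 - t)" "f (2 * c + pi / 2 - p) < f (p + pi)"
      using pb t by (auto intro!: inc)
    ultimately show ?thesis using fp half[of p] by (simp add: g_def)
  qed
  have fpos: "0 \<le> f t \<and> (f t = 0 \<longleftrightarrow> t \<in> Y)" if "p \<le> t" "t < p + 2 * pi" for t
  proof -
    \<comment> \<open>One period is cut at \<open>q\<close>, \<open>p + pi\<close> and
      \<open>q + pi\<close>. On the last two pieces \<open>f t = 2 - f (t - pi)\<close> reduces
      positivity to an upper bound for \<open>f\<close> on the first two.\<close>
    consider "t \<le> q" | "q < t" "t \<le> p + pi" | "p + pi < t" "t \<le> q + pi" | "q + pi < t"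
      by linarith
    then show ?thesis
    proof cases
      case 1
      then show ?thesis using inner[of t] fY that by force
    next
      case 2
      then have "0 < f t" using inc[of q t] fp by simp
      moreover have "t \<notin> Y" using 2 Y by (auto simp: q_def dest: Max_ge)
      ultimately show ?thesis by simp
    next
      case 3
      then have "0 < f t" using upper[of "t - pi"] half[of "t - pi"] by simp
      moreover have "q < t" using 3 pc pi_gt_zero by linarith
      then have "t \<notin> Y" using Y by (auto simp: q_def dest: Max_ge)
      ultimately show ?thesis by simp
    next
      case 4
      then have "0 < f t" using inc[of "t - pi" "p + pi"] that half[of "t - pi"] half[of p] fp by simp
      moreover have "q < t" using 4 pi_gt_zero by linarith
      then have "t \<notin> Y" using Y by (auto simp: q_def dest: Max_ge)
      ultimately show ?thesis by simp
    qed
  qed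
  have per1: "f (t + 2 * pi) = f t" for t
    using half[of t] half[of "t + pi"] by (simp add: algebra_simps)
  have pern: "f (t + 2 * pi * real n) = f t" for t n
  proof (induction n)
    case (Suc n)
    have "t + 2 * pi * real (Suc n) = (t + 2 * pi * real n) + 2 * pi" by (simp add: algebra_simps)
    then show ?case using per1 Suc by metis
  qed simp
  have per: "f (t + 2 * pi * of_int l) = f t" for t and l :: int
  proof (cases l rule: int_cases2)
    case (nonneg n)
    then show ?thesis using pern[of t n] by simp
  next
    case (nonpos n)
    then show ?thesis using pern[of "t + 2 * pi * of_int l" n] by simp
  qed
  have "0 \<le> f t \<and> (f t = 0 \<longleftrightarrow> (\<exists>y\<in>Y. \<exists>l::int. t = y + 2 * pi * l))" for t
  proof -
    define l where "l = \<lfloor>(t - p) / (2 * pi)\<rfloor>"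
    define s where "s = t - 2 * pi * of_int l"
    have "of_int l \<le> (t - p) / (2 * pi)" "(t - p) / (2 * pi) < of_int l + 1"
      unfolding l_def by linarith+
    then have "p \<le> s" "s < p + 2 * pi" by (auto simp: s_def field_simps)
    moreover have "t = s + 2 * pi * of_int l" by (simp add: s_def)
    ultimately show ?thesis using fpos[of s] per fY(1) by metis
  qed
  then show ?thesis using h(1) unfolding f_def by blast
qed

section \<open>The points on the circle\<close>

lemma sum_inverse_powers:
  fixes b :: real
  assumes "b > 1" "n \<le> m"
  shows "(\<Sum>i\<in>{n<..m}. 1 / b ^ i) = (1 / b ^ n - 1 / b ^ m) / (b - 1)"
  using assms(2)
proof (induction m rule: dec_induct)
  case (step m)
  have "{n<..Suc m} = insert (Suc m) {n<..m}" using step by auto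
  moreover have "1 / b ^ Suc m = (1 / b ^ m - 1 / b ^ Suc m) / (b - 1)"
    using assms(1) by (simp add: field_simps)
  ultimately have "(\<Sum>i\<in>{n<..Suc m}. 1 / b ^ i)
    = (1 / b ^ m - 1 / b ^ Suc m) / (b - 1) + (1 / b ^ n - 1 / b ^ m) / (b - 1)"
    using step.IH by simp
  then show ?case by (simp add: add_divide_distrib[symmetric])
qed simp

text \<open>Even the full sum over all exponents from \<open>n + 1\<close> to \<open>m\<close> stops
  short of \<open>1 / b ^ n\<close>, as \<open>b - 1 \<ge> 1\<close> and a positive remainder is
  missing.\<close>

lemma sum_inverse_powers_less:
  fixes b :: real
  assumes "b \<ge> 2" "finite A" "\<And>i. i \<in> A \<Longrightarrow> n < i"
  shows "(\<Sum>i\<in>A. 1 / b ^ i) < 1 / b ^ n"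
proof -
  define m where "m = max n (Max (insert 0 A))"
  have "A \<subseteq> {n<..m}" using assms by (auto simp: m_def le_max_iff_disj)
  then have "(\<Sum>i\<in>A. 1 / b ^ i) \<le> (\<Sum>i\<in>{n<..m}. 1 / b ^ i)"
    using assms(1) by (intro sum_mono2) auto
  also have "\<dots> = (1 / b ^ n - 1 / b ^ m) / (b - 1)"
    using assms(1) by (intro sum_inverse_powers) (auto simp: m_def)
  also have "\<dots> \<le> 1 / b ^ n - 1 / b ^ m"
  proof -
    have "1 / b ^ m \<le> 1 / b ^ n"
      using assms(1) by (intro divide_left_mono power_increasing) (auto simp: m_def)
    then have "(1 / b ^ n - 1 / b ^ m) * 1 \<le> (1 / b ^ n - 1 / b ^ m) * (b - 1)"
      using assms(1) by (intro mult_left_mono) auto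
    then show ?thesis using assms(1) by (simp add: pos_divide_le_eq)
  qed
  also have "\<dots> < 1 / b ^ n" using assms(1) by simp
  finally show ?thesis .
qed

text \<open>Lexicographic comparison: at the first difference the term \<open>1 / b ^ n\<close>
  outweighs everything that \<open>B\<close> can contribute afterwards.\<close>

lemma sum_inverse_powers_strict:
  fixes b :: real
  assumes "b \<ge> 2" "finite A" "finite B" "n \<in> A" "n \<notin> B" "\<And>i. i < n \<Longrightarrow> i \<in> A \<longleftrightarrow> i \<in> B"
  shows "(\<Sum>i\<in>B. 1 / b ^ i) < (\<Sum>i\<in>A. 1 / b ^ i)"
proof -
  let ?f = "\<lambda>i. 1 / b ^ i"
  have "B = {i\<in>B. i < n} \<union> {i\<in>B. n < i}" using assms(5) by auto (metis nat_neq_iff)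
  then have "sum ?f B = sum ?f ({i\<in>B. i < n} \<union> {i\<in>B. n < i})" by simp
  also have "\<dots> = sum ?f {i\<in>B. i < n} + sum ?f {i\<in>B. n < i}"
    using assms(3) by (intro sum.union_disjoint) auto
  also have "\<dots> < sum ?f {i\<in>B. i < n} + ?f n"
    using assms by (intro add_strict_left_mono sum_inverse_powers_less) auto
  also have "{i\<in>B. i < n} = {i\<in>A. i < n}" using assms(6) by auto
  also have "sum ?f {i\<in>A. i < n} + ?f n = sum ?f (insert n {i\<in>A. i < n})"
    using assms(2) by simp
  also have "\<dots> \<le> sum ?f A" using assms by (intro sum_mono2) auto
  finally show ?thesis .
qed

lemma sum_inverse_powers_inj:
  fixes b :: real
  assumes "b \<ge> 2" "finite A" "finite B" "(\<Sum>i\<in>A. 1 / b ^ i) = (\<Sum>i\<in>B. 1 / b ^ i)"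
  shows "A = B"
proof (rule ccontr)
  assume "A \<noteq> B"
  then obtain i where i: "(i \<in> A) \<noteq> (i \<in> B)" by blast
  define n where "n = (LEAST i. (i \<in> A) \<noteq> (i \<in> B))"
  have n: "(n \<in> A) \<noteq> (n \<in> B)" unfolding n_def using i by (rule LeastI)
  have less: "i \<in> A \<longleftrightarrow> i \<in> B" if "i < n" for i using not_less_Least[OF that[unfolded n_def]] by blast
  show False
  proof (cases "n \<in> A")
    case True
    then show False
      using n assms(4) sum_inverse_powers_strict[OF assms(1-3) _ _ less] by simp
  next
    case False
    then show False
      using n assms(4) sum_inverse_powers_strict[OF assms(1,3,2) _ _ less[symmetric]] by simp
  qed
qed

section \<open>The zero-one sequences\<close>

lemma xseq_le_1: "a \<le> 1 \<Longrightarrow> xseq I a n \<le> 1"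
  by (cases n) auto

text \<open>The recursion is made for this: each new term is chosen so that the parity of the
  partial sum records membership in \<open>I\<close>.\<close>

lemma xseq_sum_parity: "odd (\<Sum>j\<le>Suc n. xseq I a j) \<longleftrightarrow> Suc n \<in> I"
  by simp

text \<open>Raising the initial term by 1 and complementing \<open>I\<close> both flip the parity
  that determines a later term, and the flips cancel.\<close>

lemma xseq_complement:
  "n \<le> m \<Longrightarrow> xseq ({1..m} - I) 1 n = (if n = 0 then 1 else xseq I 0 n)"
proof (induction n rule: less_induct)
  case (less n)
  show ?case
  proof (cases n)
    case (Suc l)
    have "(\<Sum>j\<le>l. xseq ({1..m} - I) 1 j) = (\<Sum>j\<le>l. (if j = 0 then 1 else 0) + xseq I 0 j)"
      using less Suc by (intro sum.cong) auto
    also have "\<dots> = 1 + (\<Sum>j\<le>l. xseq I 0 j)" by (simp add: sum.distrib)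
    finally show ?thesis using Suc less.prems by auto
  qed simp
qed

text \<open>The two sequences differ only in the initial term, which contributes
  \<open>pi\<close>.\<close>

lemma tpoint_complement: "tpoint m ({1..m} - I) 1 = tpoint m I 0 + pi"
proof -
  have "(\<Sum>j\<le>m. real (xseq ({1..m} - I) 1 j) / 3 ^ j)
    = (\<Sum>j\<le>m. (if j = 0 then 1 else 0) + real (xseq I 0 j) / 3 ^ j)"
    using xseq_complement[of _ m I] by (intro sum.cong) auto
  also have "\<dots> = 1 + (\<Sum>j\<le>m. real (xseq I 0 j) / 3 ^ j)" by (simp add: sum.distrib)
  finally show ?thesis by (simp add: tpoint_def algebra_simps)
qed

section \<open>Angles and their multiples by powers of 3\<close>

definition perturbation :: "nat \<Rightarrow> nat set \<Rightarrow> real" where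
  "perturbation m I = (\<Sum>i\<in>I. 1 / 10 ^ (i + m))"

text \<open>By \<open>tpoint_complement\<close> the point starting from 1 is the antipode of the one
  starting from 0, so the bit \<open>a\<close> only adds a half turn and the sequence of
  \<open>I\<close> from 0 serves both.\<close>

definition angle :: "nat \<Rightarrow> nat set \<Rightarrow> nat \<Rightarrow> real" where
  "angle m I a = tpoint m I 0 + pi * perturbation m I + pi * real a"

text \<open>The integral and fractional parts of \<open>3 ^ n * angle m I a / \<pi>\<close>.\<close>

definition angle_int :: "nat \<Rightarrow> nat set \<Rightarrow> nat \<Rightarrow> nat" where
  "angle_int n I a = (\<Sum>j\<le>n. xseq I 0 j * 3 ^ (n - j)) + a * 3 ^ n"

definition angle_frac :: "nat \<Rightarrow> nat \<Rightarrow> nat set \<Rightarrow> real" where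
  "angle_frac m n I = 3 ^ n * ((\<Sum>j\<in>{n<..m}. real (xseq I 0 j) / 3 ^ j) + perturbation m I)"

lemma real_power_diff: "j \<le> m \<Longrightarrow> (3::real) ^ (m - j) = 3 ^ m / 3 ^ j"
  by (simp add: power_diff)

text \<open>A geometric sum; the bound fits into the room that the base-3 digits leave in the
  quarter arc, and stays below 1 after multiplication by \<open>3 ^ m\<close>.\<close>

lemma perturbation_bounds:
  assumes "I \<subseteq> {1..m}"
  shows "0 \<le> perturbation m I" "perturbation m I < 1 / (9 * 10 ^ m)"
proof -
  show "0 \<le> perturbation m I" by (auto simp: perturbation_def intro: sum_nonneg)
  have "perturbation m I \<le> (\<Sum>i\<in>{0<..m}. 1 / 10 ^ (i + m))"
    unfolding perturbation_def using assms by (intro sum_mono2) auto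
  also have "\<dots> = (\<Sum>i\<in>{0<..m}. 1 / 10 ^ i) * (1 / 10 ^ m)"
    by (simp add: sum_divide_distrib power_add)
  also have "\<dots> = (1 / 10 ^ 0 - 1 / 10 ^ m) / (10 - 1) * (1 / 10 ^ m)"
    by (subst sum_inverse_powers) auto
  also have "\<dots> < 1 / 9 * (1 / 10 ^ m)" by (intro mult_strict_right_mono) auto
  finally show "perturbation m I < 1 / (9 * 10 ^ m)" by simp
qed

lemma perturbation_inj:
  assumes "I \<subseteq> {1..m}" "J \<subseteq> {1..m}" "perturbation m I = perturbation m J"
  shows "I = J"
proof -
  have "perturbation m K = (\<Sum>i\<in>K. 1 / 10 ^ i) / 10 ^ m" for K
    by (simp add: perturbation_def power_add sum_divide_distrib)
  then have "(\<Sum>i\<in>I. 1 / (10::real) ^ i) = (\<Sum>i\<in>J. 1 / 10 ^ i)" using assms(3) by simp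
  moreover have "finite I" "finite J" using assms finite_subset by blast+
  ultimately show ?thesis using sum_inverse_powers_inj[of 10 I J] by simp
qed

text \<open>Powers of 3 are odd, so only the parities of the digit sum and of \<open>a\<close>
  matter, and \<open>xseq_sum_parity\<close> evaluates the former. For \<open>n = 0\<close> the
  digit sum is 0, in accordance with \<open>0 \<notin> I\<close>.\<close>

lemma odd_angle_int:
  assumes "0 \<notin> I"
  shows "odd (angle_int n I a) \<longleftrightarrow> odd (a + of_bool (n \<in> I))"
proof -
  have *: "even (\<Sum>j\<in>A. f j * 3 ^ (n - j)) = even (\<Sum>j\<in>A. f j)" if "finite A"
    for A and f :: "nat \<Rightarrow> nat"
    using that by (induction A rule: finite_induct) auto
  have "odd (\<Sum>j\<le>n. xseq I 0 j) \<longleftrightarrow> n \<in> I"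
  proof (cases n)
    case (Suc l)
    then show ?thesis using xseq_sum_parity[of I 0 l] by blast
  qed (use assms in auto)
  then show ?thesis unfolding angle_int_def by (auto simp: *)
qed

text \<open>Multiplication by \<open>3 ^ n\<close> turns the digits up to position \<open>n\<close>
  and the half turn into an integer multiple of \<open>pi\<close>; later digits and the perturbation
  form the rest.\<close>

lemma scaled_angle:
  assumes "n \<le> m"
  shows "3 ^ n * angle m I a = pi * real (angle_int n I a) + pi * angle_frac m n I"
proof -
  have split: "{..m} = {..n} \<union> {n<..m}" using assms by auto
  have "(\<Sum>j\<le>m. real (xseq I 0 j) / 3 ^ j)
    = (\<Sum>j\<le>n. real (xseq I 0 j) / 3 ^ j) + (\<Sum>j\<in>{n<..m}. real (xseq I 0 j) / 3 ^ j)"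
    unfolding split by (intro sum.union_disjoint) auto
  moreover have "3 ^ n * (\<Sum>j\<le>n. real (xseq I 0 j) / 3 ^ j) = real (\<Sum>j\<le>n. xseq I 0 j * 3 ^ (n - j))"
    unfolding sum_distrib_left of_nat_sum by (intro sum.cong) (auto simp: real_power_diff)
  ultimately show ?thesis
    by (simp add: angle_def tpoint_def angle_int_def angle_frac_def algebra_simps)
qed

text \<open>With all digits at most 1, the digit part falls short of \<open>1 / 2\<close> by at
  least \<open>3 ^ n / (2 * 3 ^ m)\<close>, which exceeds the scaled perturbation.\<close>

lemma angle_frac_bounds:
  assumes "n \<le> m" "I \<subseteq> {1..m}"
  shows "0 \<le> angle_frac m n I" "angle_frac m n I < 1 / 2"
proof -
  show "0 \<le> angle_frac m n I"
    unfolding angle_frac_def using perturbation_bounds(1)[OF assms(2)]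
    by (intro mult_nonneg_nonneg add_nonneg_nonneg sum_nonneg) auto
  have "(\<Sum>j\<in>{n<..m}. real (xseq I 0 j) / 3 ^ j) \<le> (\<Sum>j\<in>{n<..m}. 1 / 3 ^ j)"
    using xseq_le_1[of 0 I] by (intro sum_mono divide_right_mono) auto
  also have "\<dots> = (1 / 3 ^ n - 1 / 3 ^ m) / 2"
    using sum_inverse_powers[of 3 n m] assms by simp
  finally have "(\<Sum>j\<in>{n<..m}. real (xseq I 0 j) / 3 ^ j) + perturbation m I
    < (1 / 3 ^ n - 1 / 3 ^ m) / 2 + 1 / (9 * 10 ^ m)"
    using perturbation_bounds(2)[OF assms(2)] by linarith
  also have "(1::real) / (9 * 10 ^ m) \<le> 1 / (2 * 3 ^ m)"
    by (intro divide_left_mono mult_mono power_mono) auto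
  finally have "(\<Sum>j\<in>{n<..m}. real (xseq I 0 j) / 3 ^ j) + perturbation m I < (1 / 3 ^ n) / 2"
    by (simp add: field_simps)
  then show "angle_frac m n I < 1 / 2" by (simp add: angle_frac_def field_simps)
qed

text \<open>The base-3 digits give an integer after scaling by \<open>3 ^ m\<close>, while the perturbations stay
  below 1, so the two parts of the sum can be separated.\<close>

lemma angle_frac_inj:
  assumes "I \<subseteq> {1..m}" "J \<subseteq> {1..m}" "angle_frac m n I = angle_frac m n J"
  shows "I = J"
proof -
  define N where "N = (\<lambda>K. \<Sum>j\<in>{n<..m}. xseq K 0 j * 3 ^ (m - j))"
  have N: "3 ^ m * (\<Sum>j\<in>{n<..m}. real (xseq K 0 j) / 3 ^ j) = real (N K)" for K
    unfolding N_def sum_distrib_left of_nat_sum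
    by (intro sum.cong) (auto simp: real_power_diff)
  have "(\<Sum>j\<in>{n<..m}. real (xseq I 0 j) / 3 ^ j) + perturbation m I
      = (\<Sum>j\<in>{n<..m}. real (xseq J 0 j) / 3 ^ j) + perturbation m J"
    using assms(3) by (simp add: angle_frac_def)
  from arg_cong[OF this, of "\<lambda>x. 3 ^ m * x"]
  have *: "real (N I) + 3 ^ m * perturbation m I = real (N J) + 3 ^ m * perturbation m J"
    by (simp add: distrib_left N)
  have bd: "0 \<le> 3 ^ m * perturbation m K" "3 ^ m * perturbation m K < 1" if "K \<subseteq> {1..m}" for K
  proof -
    show "0 \<le> 3 ^ m * perturbation m K" using perturbation_bounds[OF that] by simp
    have "3 ^ m * perturbation m K < 3 ^ m * (1 / (9 * 10 ^ m))"
      using perturbation_bounds(2)[OF that] by (intro mult_strict_left_mono) auto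
    also have "\<dots> \<le> 10 ^ m * (1 / (9 * 10 ^ m))" by (intro mult_right_mono power_mono) auto
    finally show "3 ^ m * perturbation m K < 1" by simp
  qed
  have "N I = N J" using * bd[OF assms(1)] bd[OF assms(2)] by linarith
  then show ?thesis using * perturbation_inj[OF assms(1,2)] by simp
qed

section \<open>Coordinates of the curve\<close>

lemma nth_concat_map:
  assumes "\<And>x. x \<in> set xs \<Longrightarrow> length (f x) = L" "j < length xs" "i < L"
  shows "concat (map f xs) ! (L * j + i) = f (xs ! j) ! i"
  using assms
proof (induction xs arbitrary: j)
  case (Cons x xs)
  then show ?case
    by (cases j) (auto simp: nth_append)
qed simp

lemma U_list_nth:
  assumes "q < 2 * k"
  shows "U_list k t ! q = (if even q then cos else sin) (real (2 * (q div 2) + 1) * t)"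
proof -
  have "U_list k t ! (2 * (q div 2) + q mod 2)
    = [cos (real (2 * ([0..<k] ! (q div 2)) + 1) * t), sin (real (2 * ([0..<k] ! (q div 2)) + 1) * t)] ! (q mod 2)"
    unfolding U_list_def using assms by (intro nth_concat_map) auto
  moreover have "[0..<k] ! (q div 2) = q div 2" using assms by simp
  moreover have "[x, y] ! (q mod 2) = (if even q then x else y)" for x y :: real
    by (cases "even q") (auto simp: odd_iff_mod_2_eq_one)
  ultimately have "U_list k t ! q = (if even q then cos (real (2 * (q div 2) + 1) * t)
      else sin (real (2 * (q div 2) + 1) * t))"
    by (simp only: mult_div_mod_eq)
  then show ?thesis by (cases "even q") (simp_all only: if_True if_False simp_thms)
qed

lemma Psi_list_nth:
  assumes "p < 2 * k * (m + 1)"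
  shows "Psi_list k m t ! p = (if even p then cos else sin)
    (real (3 ^ (p div (2 * k)) * (2 * (p mod (2 * k) div 2) + 1)) * t)"
proof -
  let ?j = "p div (2 * k)" and ?q = "p mod (2 * k)"
  have k: "2 * k > 0" using assms by (cases k) auto
  have j: "?j < m + 1" using assms by (simp add: less_mult_imp_div_less mult.commute)
  have "Psi_list k m t ! (2 * k * ?j + ?q) = U_list k (3 ^ ([0..<m + 1] ! ?j) * t) ! ?q"
    unfolding Psi_list_def using j k by (intro nth_concat_map) (auto simp: length_U_list)
  moreover have "[0..<m + 1] ! ?j = ?j" using j by (simp del: upt_Suc)
  moreover have "even ?q \<longleftrightarrow> even p" by (simp add: dvd_mod_iff)
  moreover have "?q < 2 * k" using k by simp
  moreover have "real (2 * i + 1) * (3 ^ ?j * t) = real (3 ^ ?j * (2 * i + 1)) * t" for i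
    by (simp add: algebra_simps)
  ultimately show ?thesis by (simp only: mult_div_mod_eq U_list_nth)
qed

definition position :: "'n::{finite,linorder} \<Rightarrow> nat" where
  "position i = card {j. j < i}"

lemma Psi_nth: "Psi k m t $ i = Psi_list k m t ! position i"
  by (simp add: Psi_def position_def)

lemma position_less:
  fixes i :: "'n::{finite,linorder}"
  shows "position i < CARD('n)"
proof -
  have "i \<notin> {j. j < i}" by simp
  then have "{j. j < i} \<subset> UNIV" by blast
  then show ?thesis unfolding position_def by (intro psubset_card_mono) auto
qed

lemma position_surj:
  assumes "p < CARD('n::{finite,linorder})"
  obtains i :: "'n::{finite,linorder}" where "position i = p"
proof -
  have "strict_mono (position :: 'n \<Rightarrow> nat)"
    unfolding strict_mono_def position_def by (auto intro!: psubset_card_mono)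
  then have "card (range (position :: 'n \<Rightarrow> nat)) = CARD('n)"
    by (intro card_image) (rule strict_mono_imp_inj_on)
  moreover have "range (position :: 'n \<Rightarrow> nat) \<subseteq> {..<CARD('n)}" using position_less by auto
  ultimately have "range (position :: 'n \<Rightarrow> nat) = {..<CARD('n)}"
    by (intro card_subset_eq) auto
  then show ?thesis using assms that by (metis imageE lessThan_iff)
qed

lemma Psi_coordinate:
  assumes "CARD('n::{finite,linorder}) = 2 * k * (m + 1)" "i < k" "n \<le> m"
  obtains p q :: "'n::{finite,linorder}" where
    "\<And>t. Psi k m t $ p = cos (real (3 ^ n * (2 * i + 1)) * t)"
    "\<And>t. Psi k m t $ q = sin (real (3 ^ n * (2 * i + 1)) * t)"
proof -
  have less: "2 * k * n + (2 * i + e) < 2 * k * (m + 1)" if "e < 2" for e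
  proof -
    have "2 * k * n + (2 * i + e) < 2 * k * n + 2 * k" using assms that by simp
    also have "\<dots> = 2 * k * (n + 1)" by simp
    also have "\<dots> \<le> 2 * k * (m + 1)" using assms(3) by (intro mult_le_mono2) auto
    finally show ?thesis .
  qed
  have m: "(2 * k * n + (2 * i + e)) div (2 * k) = n" "(2 * k * n + (2 * i + e)) mod (2 * k) = 2 * i + e"
    if "e < 2" for e
    using assms that by (simp_all add: div_mult_self4 del: mult_Suc)
  obtain p q :: 'n where "position p = 2 * k * n + (2 * i + 0)" "position q = 2 * k * n + (2 * i + 1)"
    using position_surj[where 'n='n] less[of 0] less[of 1] assms(1) by (metis one_less_numeral_iff semiring_norm(76) zero_less_numeral)
  then have "Psi k m t $ p = cos (real (3 ^ n * (2 * i + 1)) * t)"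
    "Psi k m t $ q = sin (real (3 ^ n * (2 * i + 1)) * t)" for t
    unfolding Psi_nth using Psi_list_nth[OF less[of 0], of t] Psi_list_nth[OF less[of 1], of t]
      m[of 0] m[of 1] by simp_all
  then show ?thesis by (rule that)
qed

text \<open>The Fourier coefficients of \<open>h\<close> are placed on the coordinates of block
  \<open>n\<close>, whose frequencies are \<open>3 ^ n\<close> times the odd numbers below
  \<open>2 * k\<close>. This turns nonnegative forms into supporting hyperplanes.\<close>

lemma trig_form_functional:
  assumes "CARD('n::{finite,linorder}) = 2 * k * (m + 1)" "n \<le> m" "trig_form (2 * k - 1) h" "k \<ge> 1"
  shows "\<exists>A :: real ^ 'n::{finite,linorder}. \<forall>t. A \<bullet> Psi k m t = h (3 ^ n * t)"
proof -
  have "trig_sum (2 * k - 1) h" using assms by (intro trig_form_imp_trig_sum)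
  then show ?thesis
  proof (induction rule: trig_sum.induct)
    case zero
    then show ?case by (intro exI[of _ 0]) auto
  next
    case (add_term j f a b)
    then obtain A :: "(real, 'n) vec" where A: "\<And>t. A \<bullet> Psi k m t = f (3 ^ n * t)" by blast
    have "odd j" using add_term assms(4) by (cases k) auto
    then obtain i where i: "j = 2 * i + 1" by (elim oddE)
    then have "i < k" using add_term assms(4) by linarith
    then obtain p q :: 'n where pq:
      "\<And>t. Psi k m t $ p = cos (real (3 ^ n * (2 * i + 1)) * t)"
      "\<And>t. Psi k m t $ q = sin (real (3 ^ n * (2 * i + 1)) * t)"
      using Psi_coordinate[OF assms(1) _ assms(2)] by metis
    have "(a *\<^sub>R axis p 1 + b *\<^sub>R axis q 1 + A) \<bullet> Psi k m t
      = a * cos (real j * (3 ^ n * t)) + b * sin (real j * (3 ^ n * t)) + f (3 ^ n * t)" for t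
      unfolding i by (simp add: inner_add_left inner_axis' A pq algebra_simps)
    then show ?case by blast
  qed
qed

text \<open>Every frequency on the curve is odd; this yields central symmetry.\<close>

lemma Psi_add_pi:
  assumes "CARD('n::{finite,linorder}) = 2 * k * (m + 1)"
  shows "(Psi k m (t + pi) :: real ^ 'n::{finite,linorder}) = - Psi k m t"
proof -
  have "(if even p then cos else sin) (real l * (t + pi)) = - (if even p then cos else sin) (real l * t)"
    if "odd l" for l p :: nat
  proof -
    have "real l * (t + pi) = real l * t + real l * pi" by (simp add: distrib_left)
    then show ?thesis using that by (simp add: cos_add sin_add cos_npi sin_npi)
  qed
  from this[of "3 ^ _ * (2 * _ + 1)"] show ?thesis
    unfolding vec_eq_iff using position_less[where 'n='n] assms
    by (simp add: Psi_nth Psi_list_nth del: of_nat_mult of_nat_power of_nat_add)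
qed

section \<open>Repeated frequencies and the dimension bound\<close>

text \<open>The frequency \<open>3 ^ (j + 1) * (2 * i + 1)\<close> already occurs as \<open>3 ^ j * (2 * (3 * i + 1) + 1)\<close> when
  \<open>3 * i + 1 < k\<close>, that is, when \<open>i < (k + 1) div 3\<close>.\<close>

lemma card_frequencies:
  "card ((\<lambda>(j, i). 3 ^ j * (2 * i + 1)) ` ({..m} \<times> {..<k}) :: nat set)
    \<le> k + m * (k - (k + 1) div 3)"
proof -
  define q where "q = (k + 1) div 3"
  let ?f = "\<lambda>(j, i). 3 ^ j * (2 * i + 1) :: nat"
  \<comment> \<open>Representatives of all frequencies: block 0 in full, and from each later block
    only the indices from \<open>q\<close> on.\<close>
  let ?D = "{0} \<times> {..<k} \<union> {1..m} \<times> {q..<k}"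
  have "3 ^ j * (2 * i + 1) \<in> ?f ` ?D" if "j \<le> m" "i < k" for i j
    using that
  proof (induction j arbitrary: i)
    case 0
    then show ?case by (intro image_eqI[of _ _ "(0, i)"]) auto
  next
    case (Suc j)
    show ?case
    proof (cases "i < q")
      case True
      then have "3 * i + 1 < k" unfolding q_def by linarith
      with Suc have "3 ^ j * (2 * (3 * i + 1) + 1) \<in> ?f ` ?D" by (intro Suc.IH) auto
      moreover have "3 ^ j * (2 * (3 * i + 1) + 1) = 3 ^ Suc j * (2 * i + 1)" by simp
      ultimately show ?thesis by metis
    next
      case False
      then show ?thesis using Suc.prems by (intro image_eqI[of _ _ "(Suc j, i)"]) auto
    qed
  qed
  then have "?f ` ({..m} \<times> {..<k}) \<subseteq> ?f ` ?D" by auto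
  then have "card (?f ` ({..m} \<times> {..<k})) \<le> card (?f ` ?D)"
    by (intro card_mono) auto
  also have "\<dots> \<le> card ?D" by (intro card_image_le) auto
  also have "\<dots> \<le> card ({0::nat} \<times> {..<k}) + card ({1..m} \<times> {q..<k})" by (rule card_Un_le)
  finally show ?thesis by (simp add: q_def)
qed

text \<open>Coordinates of the same kind, cosine or sine, and the same frequency coincide along the
  curve, so it lies in the span of one indicator vector per class. There are at most twice as many
  classes as distinct frequencies.\<close>

lemma aff_dim_Psi:
  assumes "CARD('n::{finite,linorder}) = 2 * k * (m + 1)"
  shows "aff_dim (convex hull (Psi k m ` V) :: (real ^ 'n::{finite,linorder}) set)
    \<le> 2 * int k * (int m + 1) - 2 * int m * int ((k + 1) div 3)"
proof -
  define fr where "fr = (\<lambda>p. 3 ^ (p div (2 * k)) * (2 * (p mod (2 * k) div 2) + 1) :: nat)"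
  define lab where "lab = (\<lambda>i :: 'n. (even (position i), fr (position i)))"
  define L where "L = range lab"
  define v where "v = (\<lambda>l. (\<chi> i. if lab i = l then 1 else 0) :: (real, 'n) vec)"
  define F where "F = ((\<lambda>(j, i). 3 ^ j * (2 * i + 1)) ` ({..m} \<times> {..<k}) :: nat set)"
  have "lab i \<in> UNIV \<times> F" for i
  proof -
    have p: "position i < (m + 1) * (2 * k)" using position_less[of i] assms by (simp add: mult_ac)
    have "k > 0" using p by (cases k) auto
    then have "position i mod (2 * k) < k * 2" by (simp add: mult.commute)
    then have "position i mod (2 * k) div 2 < k" by (rule less_mult_imp_div_less)
    moreover have "position i div (2 * k) < m + 1" using p by (rule less_mult_imp_div_less)
    ultimately have "fr (position i) \<in> F" unfolding fr_def F_def
      by (intro image_eqI[of _ _ "(position i div (2 * k), position i mod (2 * k) div 2)"]) auto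
    then show ?thesis by (simp add: lab_def)
  qed
  then have "L \<subseteq> UNIV \<times> F" unfolding L_def by blast
  then have "card L \<le> card ((UNIV :: bool set) \<times> F)" by (intro card_mono) (auto simp: F_def)
  also have "\<dots> = 2 * card F" by (simp add: card_cartesian_product)
  also have "\<dots> \<le> 2 * (k + m * (k - (k + 1) div 3))"
    using card_frequencies[of m k] unfolding F_def by simp
  finally have cL: "card L \<le> 2 * (k + m * (k - (k + 1) div 3))" .
  have "Psi k m t \<in> span (v ` L)" for t
  proof -
    define val where "val = (\<lambda>l :: bool \<times> nat. (if fst l then cos else sin) (real (snd l) * t))"
    have "Psi k m t = (\<Sum>l\<in>L. val l *\<^sub>R v l)"
    proof (subst vec_eq_iff, intro allI)
      fix i :: 'n
      have "(\<Sum>l\<in>L. val l *\<^sub>R v l) $ i = (\<Sum>l\<in>L. if lab i = l then val l else 0)"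
        unfolding sum_component by (intro sum.cong) (auto simp: v_def)
      also have "\<dots> = val (lab i)" by (simp add: L_def)
      also have "\<dots> = Psi k m t $ i"
        using position_less[of i] assms by (simp add: Psi_nth Psi_list_nth val_def lab_def fr_def)
      finally show "Psi k m t $ i = (\<Sum>l\<in>L. val l *\<^sub>R v l) $ i" by simp
    qed
    then show ?thesis by (simp only:) (intro span_sum span_scale span_base imageI)
  qed
  then have "convex hull (Psi k m ` V) \<subseteq> span (v ` L)"
    by (intro hull_minimal) (auto simp: subspace_imp_convex)
  then have "aff_dim (convex hull (Psi k m ` V) :: (real, 'n) vec set) \<le> aff_dim (span (v ` L))"
    by (rule aff_dim_subset)
  also have "\<dots> = int (dim (v ` L))" by (simp add: aff_dim_subspace)
  also have "dim (v ` L) \<le> card (v ` L)" by (intro dim_le_card') (auto simp: L_def)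
  also have "card (v ` L) \<le> card L" by (intro card_image_le) (auto simp: L_def)
  also have "int (card L) \<le> int (2 * (k + m * (k - (k + 1) div 3)))" using cL by linarith
  also have "\<dots> = 2 * int k * (int m + 1) - 2 * int m * int ((k + 1) div 3)"
  proof -
    have "(k + 1) div 3 \<le> k" by linarith
    then have "int (k - (k + 1) div 3) = int k - int ((k + 1) div 3)" by (rule of_nat_diff)
    then show ?thesis
      by (simp only: of_nat_mult of_nat_add of_nat_numeral) (simp only: algebra_simps mult_1_right)
  qed
  finally show ?thesis by simp
qed

section \<open>Faces\<close>

text \<open>The parity hypothesis puts all points of \<open>Q\<close>, scaled by
  \<open>3 ^ n\<close>, in the quarter arc from 0 or from \<open>pi\<close> according to
  \<open>b\<close>. The form exposing them there, composed with the scaling, is a linear functional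
  along the curve.\<close>

lemma supporting_functional:
  fixes Q :: "(nat set \<times> nat) set"
  assumes n: "CARD('n::{finite,linorder}) = 2 * k * (m + 1)" "n \<le> m"
    and Q: "finite Q" "Q \<noteq> {}" "card Q \<le> k" "Q \<subseteq> Pow {1..m} \<times> {0, 1}"
    and parity: "\<And>I a. (I, a) \<in> Q \<Longrightarrow> odd (a + of_bool (n \<in> I)) \<longleftrightarrow> b"
  shows "\<exists>A :: (real, 'n) vec. \<forall>I a. I \<subseteq> {1..m} \<and> a \<in> {0, 1} \<longrightarrow>
    -1 \<le> A \<bullet> Psi k m (angle m I a) \<and> (A \<bullet> Psi k m (angle m I a) = -1 \<longleftrightarrow> (I, a) \<in> Q)"
proof -
  define \<beta> :: int where "\<beta> = of_bool b"
  define y where "y = (\<lambda>I. pi * of_int \<beta> + pi * angle_frac m n I)"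
  define Y where "Y = y ` fst ` Q"
  \<comment> \<open>Centring at half the largest fractional part \<open>r\<close> makes all
    distances strictly less than \<open>pi / 4\<close>; the midpoint of the half-open quarter arc
    would lie at distance \<open>pi / 4\<close> from a point with fractional part 0.\<close>
  define r where "r = Max (angle_frac m n ` fst ` Q)"
  have sub: "I \<subseteq> {1..m}" if "(I, a) \<in> Q" for I a using Q(4) that by auto
  have "r \<in> angle_frac m n ` fst ` Q" unfolding r_def using Q by (intro Max_in) auto
  then obtain I0 a0 where "(I0, a0) \<in> Q" "r = angle_frac m n I0" by auto
  then have "r < 1 / 2" using angle_frac_bounds(2)[OF n(2)] sub by blast
  then have r: "pi * r < pi / 2" using mult_strict_left_mono[of r "1 / 2" pi] by simp
  have "\<bar>z - (pi * of_int \<beta> + pi * r / 2)\<bar> < pi / 4" if "z \<in> Y" for z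
  proof -
    from that obtain I a where I: "(I, a) \<in> Q" "z = y I" unfolding Y_def by auto
    have "angle_frac m n I \<le> r" unfolding r_def using Q I(1) by (intro Max_ge) force+
    then have "pi * angle_frac m n I \<le> pi * r" by simp
    moreover have "0 \<le> pi * angle_frac m n I" using angle_frac_bounds(1)[OF n(2) sub[OF I(1)]] by simp
    ultimately show ?thesis using r unfolding I(2) y_def by linarith
  qed
  moreover have "finite Y" "Y \<noteq> {}" using Q by (auto simp: Y_def)
  ultimately obtain h where h: "trig_form (2 * card Y - 1) h" "\<And>t. 0 \<le> 1 + h t"
    "\<And>t. 1 + h t = 0 \<longleftrightarrow> (\<exists>z\<in>Y. \<exists>l::int. t = z + 2 * pi * l)"
    using trig_form_supporting[of Y "pi * of_int \<beta> + pi * r / 2"] by blast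
  have "card Y \<le> card Q" unfolding Y_def image_image using Q(1) by (intro card_image_le)
  moreover have "card Y > 0" using \<open>finite Y\<close> \<open>Y \<noteq> {}\<close> by (simp add: card_gt_0_iff)
  \<comment> \<open>If \<open>Y\<close> has fewer than \<open>k\<close> points, the degree is raised
    by an even amount to \<open>2 * k - 1\<close>.\<close>
  ultimately have "2 * card Y - 1 + 2 * (k - card Y) = 2 * k - 1" "k \<ge> 1" using Q(3) by auto
  then have "trig_form (2 * k - 1) h" using trig_form_raise[OF h(1), of "k - card Y"] by simp
  from trig_form_functional[OF n this \<open>k \<ge> 1\<close>]
  obtain A :: "(real, 'n) vec" where A: "\<And>t. A \<bullet> Psi k m t = h (3 ^ n * t)" by blast
  have "A \<bullet> Psi k m (angle m I a) = -1 \<longleftrightarrow> (I, a) \<in> Q" if I: "I \<subseteq> {1..m}" "a \<in> {0, 1}" for I a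
  proof -
    have eq: "3 ^ n * angle m I a = pi * real (angle_int n I a) + pi * angle_frac m n I"
      by (rule scaled_angle[OF n(2)])
    have par: "odd (angle_int n J c) \<longleftrightarrow> odd (c + of_bool (n \<in> J))" if "J \<subseteq> {1..m}" for J c
      using that by (intro odd_angle_int) auto
    have "A \<bullet> Psi k m (angle m I a) = -1 \<longleftrightarrow> 1 + h (3 ^ n * angle m I a) = 0"
      unfolding A by linarith
    also have "\<dots> \<longleftrightarrow> (\<exists>z\<in>Y. \<exists>l::int. 3 ^ n * angle m I a = z + 2 * pi * l)" by (rule h(3))
    also have "\<dots> \<longleftrightarrow> (I, a) \<in> Q"
    proof
      assume "\<exists>z\<in>Y. \<exists>l::int. 3 ^ n * angle m I a = z + 2 * pi * l"
      then obtain J c l where J: "(J, c) \<in> Q" "3 ^ n * angle m I a = y J + 2 * pi * of_int l"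
        unfolding Y_def by auto
      from J(2) have "pi * (of_int (int (angle_int n I a)) + angle_frac m n I)
        = pi * (of_int (\<beta> + 2 * l) + angle_frac m n J)"
        unfolding eq y_def by (simp add: algebra_simps)
      then have e: "of_int (int (angle_int n I a)) + angle_frac m n I
        = of_int (\<beta> + 2 * l) + angle_frac m n J" by simp
      \<comment> \<open>Both fractional parts lie in \<open>[0, 1 / 2)\<close>, so the integer parts
        agree; then the fractional part identifies \<open>I\<close> and the parity identifies
        \<open>a\<close>.\<close>
      then have l: "int (angle_int n I a) = \<beta> + 2 * l"
        using angle_frac_bounds[OF n(2) I(1)] angle_frac_bounds[OF n(2) sub[OF J(1)]] by linarith
      then have "I = J"
        using e I(1) sub[OF J(1)] by (intro angle_frac_inj[of I m J n]) auto
      from l have "odd (int (angle_int n I a)) \<longleftrightarrow> odd \<beta>" by simp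
      then have "odd (angle_int n I a) \<longleftrightarrow> b" by (simp add: \<beta>_def)
      then have "odd (a + of_bool (n \<in> I)) \<longleftrightarrow> odd (c + of_bool (n \<in> I))"
        using par[OF I(1)] parity[OF J(1)] \<open>I = J\<close> by simp
      moreover have "c \<in> {0, 1}" using J(1) Q(4) by auto
      ultimately have "a = c" using I(2) by auto
      then show "(I, a) \<in> Q" using J(1) \<open>I = J\<close> by simp
    next
      assume "(I, a) \<in> Q"
      then have "odd (angle_int n I a) \<longleftrightarrow> b" using par[OF I(1)] parity by simp
      then have "even (int (angle_int n I a) - \<beta>)" by (cases b) (auto simp: \<beta>_def)
      then obtain l where "int (angle_int n I a) - \<beta> = 2 * l" by (elim evenE)
      then have "int (angle_int n I a) = \<beta> + 2 * l" by simp
      then have "real (angle_int n I a) = of_int \<beta> + 2 * of_int l"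
        by (metis of_int_add of_int_mult of_int_numeral of_int_of_nat_eq)
      then have "3 ^ n * angle m I a = y I + 2 * pi * of_int l"
        unfolding eq y_def by (simp add: algebra_simps)
      moreover have "y I \<in> Y" unfolding Y_def using \<open>(I, a) \<in> Q\<close> by force
      ultimately show "\<exists>z\<in>Y. \<exists>l::int. 3 ^ n * angle m I a = z + 2 * pi * l" by blast
    qed
    finally show ?thesis .
  qed
  moreover have "-1 \<le> A \<bullet> Psi k m t" for t using h(2)[of "3 ^ n * t"] unfolding A by linarith
  ultimately show ?thesis by blast
qed

text \<open>The hyperplane cuts out a face, which is the hull of some points of \<open>X\<close>;
  these lie on the hyperplane and hence in \<open>S\<close>.\<close>

lemma face_of_convex_hull_supporting:
  fixes X :: "'a::euclidean_space set"
  assumes "finite X" "S \<subseteq> X" "\<And>x. x \<in> X \<Longrightarrow> b \<le> A \<bullet> x" "\<And>x. x \<in> X \<Longrightarrow> A \<bullet> x = b \<longleftrightarrow> x \<in> S"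
  shows "(convex hull S) face_of (convex hull X)"
proof -
  let ?F = "convex hull X \<inter> {x. A \<bullet> x = b}"
  have "convex hull X \<subseteq> {x. b \<le> A \<bullet> x}"
    using assms(3) by (intro hull_minimal) (auto simp: convex_halfspace_ge)
  then have face: "?F face_of (convex hull X)"
    by (intro face_of_Int_supporting_hyperplane_ge) auto
  then obtain S' where S': "S' \<subseteq> X" "?F = convex hull S'"
    using face_of_convex_hull_subset[OF finite_imp_compact[OF assms(1)]] by blast
  have "S' \<subseteq> ?F" unfolding S'(2) by (rule hull_subset)
  then have "S' \<subseteq> S" using S'(1) assms(4) by blast
  then have "?F \<subseteq> convex hull S" unfolding S'(2) by (rule hull_mono)
  moreover have "S \<subseteq> ?F" using assms(2,4) hull_subset[of X convex] by blast
  then have "convex hull S \<subseteq> ?F"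
    by (intro hull_minimal) (auto intro: convex_Int convex_hyperplane)
  ultimately show ?thesis using face by (metis subset_antisym)
qed

text \<open>For each \<open>s\<close> the hyperplane contains the affine hull of the other points
  but not \<open>s\<close>.\<close>

lemma affine_independent_supporting:
  fixes S :: "'a::real_inner set"
  assumes "\<And>s. s \<in> S \<Longrightarrow> \<exists>A. (\<forall>x\<in>S - {s}. A \<bullet> x = b) \<and> A \<bullet> s \<noteq> b"
  shows "\<not> affine_dependent S"
  unfolding affine_dependent_def
proof
  assume "\<exists>x\<in>S. x \<in> affine hull (S - {x})"
  then obtain s where s: "s \<in> S" "s \<in> affine hull (S - {s})" by blast
  obtain A where A: "\<forall>x\<in>S - {s}. A \<bullet> x = b" "A \<bullet> s \<noteq> b" using assms[OF s(1)] by blast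
  have "affine hull (S - {s}) \<subseteq> {x. A \<bullet> x = b}"
    using A(1) by (intro hull_minimal) (auto simp: affine_hyperplane)
  then show False using s(2) A(2) by blast
qed

section \<open>Vertices, symmetry and neighborliness of the polytope\<close>

theorem theorem5p2:
  fixes k m :: nat
    and \<F> :: "nat set set"
    and \<epsilon> :: "nat set \<Rightarrow> real"
    and P :: "(real ^ 'n::{finite,linorder}) set"
  assumes "m \<ge> 1" and "k \<ge> 3"
    and "\<F> \<subseteq> Pow {1..m}"
    and "k_independent m k \<F>"
    and "\<And>I. I \<in> \<F> \<Longrightarrow> \<epsilon> I = (\<Sum>i\<in>I. 1 / 10 ^ (i + m))"
    and "CARD('n) = 2 * k * (m + 1)"
    and "P = P_poly k m (Veps m \<epsilon> \<F>)"
  shows "polytope P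
    \<and> centrally_symmetric P
    \<and> k_neighborly k P
    \<and> aff_dim P \<le> 2 * int k * (int m + 1) - 2 * int m * int ((k + 1) div 3)
    \<and> card (vertices P) = 2 * card \<F>"
proof -
  note F = assms(3) and n = assms(6)
  define g :: "nat set \<times> nat \<Rightarrow> (real, 'n) vec" where "g = (\<lambda>(I, a). Psi k m (angle m I a))"
  define D where "D = \<F> \<times> {0, 1 :: nat}"
  define X where "X = g ` D"
  have "finite \<F>" using F finite_subset by blast
  then have fin: "finite D" "finite X" by (auto simp: D_def X_def)
  have D: "q \<in> Pow {1..m} \<times> {0, 1}" if "q \<in> D" for q using that F by (auto simp: D_def)
  have "Veps m \<epsilon> \<F> = (\<lambda>(I, a). angle m I a) ` D"
    using assms(5) unfolding Veps_def D_def angle_def tpoint_complement perturbation_def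
    by (auto simp: algebra_simps image_iff)
  then have P: "P = convex hull X"
    unfolding assms(7) P_poly_def X_def g_def by (simp add: case_prod_unfold image_image)
  have functional: "\<exists>A. \<forall>q\<in>D. -1 \<le> A \<bullet> g q \<and> (A \<bullet> g q = -1 \<longleftrightarrow> q \<in> Q)"
    if "l \<le> m" "Q \<subseteq> D" "Q \<noteq> {}" "card Q \<le> k" "\<And>I a. (I, a) \<in> Q \<Longrightarrow> odd (a + of_bool (l \<in> I)) \<longleftrightarrow> b"
    for l Q b
  proof -
    have "finite Q" "Q \<subseteq> Pow {1..m} \<times> {0, 1}" using that D fin finite_subset by blast+
    from supporting_functional[OF n that(1) this(1) that(3,4) this(2) that(5)]
    obtain A :: "(real, 'n) vec" where A: "\<And>I a. I \<subseteq> {1..m} \<Longrightarrow> a \<in> {0, 1} \<Longrightarrow>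
      -1 \<le> A \<bullet> Psi k m (angle m I a) \<and> (A \<bullet> Psi k m (angle m I a) = -1 \<longleftrightarrow> (I, a) \<in> Q)" by blast
    have "-1 \<le> A \<bullet> g q \<and> (A \<bullet> g q = -1 \<longleftrightarrow> q \<in> Q)" if "q \<in> D" for q
    proof (cases q)
      case (Pair I a)
      then show ?thesis using D[OF that] A[of I a] by (simp add: g_def)
    qed
    then show ?thesis by blast
  qed
  \<comment> \<open>At level 0 the parity condition concerns only the bit, since 0 belongs to no
    member of the family, so each single point is exposed. This gives both injectivity of
    \<open>g\<close> and the vertices.\<close>
  have single: "\<exists>A. \<forall>p\<in>D. -1 \<le> A \<bullet> g p \<and> (A \<bullet> g p = -1 \<longleftrightarrow> p = q)" if "q \<in> D" for q
  proof -
    have "0 \<notin> fst q" using D[OF that] by auto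
    then have "\<exists>A. \<forall>p\<in>D. -1 \<le> A \<bullet> g p \<and> (A \<bullet> g p = -1 \<longleftrightarrow> p \<in> {q})"
      using that assms(2) by (intro functional[of 0 "{q}" "odd (snd q)"]) auto
    then show ?thesis by simp
  qed
  have inj: "inj_on g D"
  proof (rule inj_onI)
    fix p q assume "p \<in> D" "q \<in> D" "g p = g q"
    then show "p = q" using single[of q] by metis
  qed
  have vert: "vertices P = X"
  proof
    show "vertices P \<subseteq> X"
      unfolding vertices_def P by (rule extreme_points_of_convex_hull)
    show "X \<subseteq> vertices P"
    proof
      fix x assume "x \<in> X"
      then obtain q where q: "q \<in> D" "x = g q" by (auto simp: X_def)
      obtain A where A: "\<forall>p\<in>D. -1 \<le> A \<bullet> g p \<and> (A \<bullet> g p = -1 \<longleftrightarrow> p = q)"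
        using single[OF q(1)] by blast
      have "(convex hull {x}) face_of (convex hull X)"
      proof (rule face_of_convex_hull_supporting[where A = A])
        fix z assume "z \<in> X"
        then obtain p where p: "p \<in> D" "z = g p" by (auto simp: X_def)
        show "-1 \<le> A \<bullet> z" using A p by blast
        have "A \<bullet> z = -1 \<longleftrightarrow> p = q" using A p by blast
        also have "\<dots> \<longleftrightarrow> z \<in> {x}" unfolding p(2) q(2) using inj_on_eq_iff[OF inj p(1) q(1)] by simp
        finally show "A \<bullet> z = -1 \<longleftrightarrow> z \<in> {x}" .
      qed (use fin \<open>x \<in> X\<close> in auto)
      then show "x \<in> vertices P" unfolding vertices_def P by (simp add: face_of_singleton)
    qed
  qed
  have neg: "g (I, 1 - a) = - g (I, a)" if "a \<in> {0, 1}" for I a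
  proof -
    have "g (I, 1) = - g (I, 0)"
      using Psi_add_pi[OF n, of "angle m I 0"] by (simp add: g_def angle_def)
    then show ?thesis using that by auto
  qed
  have "uminus ` X = X"
  proof -
    have sub: "uminus ` X \<subseteq> X"
    proof
      fix x assume "x \<in> uminus ` X"
      then obtain I a where I: "(I, a) \<in> D" "x = - g (I, a)" by (auto simp: X_def)
      then have "x = g (I, 1 - a)" "(I, 1 - a) \<in> D" using neg[of a I] by (auto simp: D_def)
      then show "x \<in> X" by (auto simp: X_def)
    qed
    then have "uminus ` (uminus ` X) \<subseteq> uminus ` X" by (rule image_mono)
    then show ?thesis using sub by (simp add: image_image)
  qed
  then have "centrally_symmetric P"
    unfolding centrally_symmetric_def P
    by (metis convex_hull_linear_image linear_uminus)
  moreover have "k_neighborly k P"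
    unfolding k_neighborly_def vert
  proof (intro allI impI, elim conjE)
    fix S assume S: "S \<subseteq> X" "finite S" "card S = k" "pairwise (\<lambda>v w. w \<noteq> - v) S"
    define Q where "Q = {q \<in> D. g q \<in> S}"
    have gQ: "g ` Q = S" using S(1) by (auto simp: Q_def X_def)
    have QD: "Q \<subseteq> D" by (auto simp: Q_def)
    have injQ: "inj_on g Q" using inj QD by (rule inj_on_subset)
    have cQ: "card Q = k" using card_image[OF injQ] gQ S(3) by simp
    have finQ: "finite Q" using QD fin(1) by (rule finite_subset)
    \<comment> \<open>Two points with the same set but different bits would be antipodes, which
      \<open>S\<close> excludes; so there are \<open>k\<close> distinct sets to which
      \<open>k\<close>-independence applies.\<close>
    have inj_fst: "inj_on fst Q"
    proof (rule inj_onI, rule ccontr)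
      fix p q assume pq: "p \<in> Q" "q \<in> Q" "fst p = fst q" "p \<noteq> q"
      obtain I a where p: "p = (I, a)" by (cases p)
      obtain c where q: "q = (I, c)" using pq(3) p by (cases q) auto
      have a: "a \<in> {0, 1}" "c \<in> {0, 1}" using pq(1,2) QD p q by (auto simp: D_def)
      moreover have "a \<noteq> c" using pq(4) p q by simp
      ultimately have "q = (I, 1 - a)" using q by auto
      then have "g q = - g p" using neg[OF a(1)] p by simp
      moreover have "g p \<in> S" "g q \<in> S" "g p \<noteq> g q"
        using pq injQ by (auto simp: Q_def inj_on_eq_iff)
      ultimately show False using S(4) unfolding pairwise_def by blast
    qed
    obtain e where e: "bij_betw e {1..k} Q"
      using ex_bij_betw_nat_finite_1[OF finQ] cQ by blast
    define I where "I = (\<lambda>j. fst (e j))"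
    \<comment> \<open>With this choice, a common element \<open>l\<close> of the sets
      \<open>J j\<close> makes \<open>a + of_bool (l \<in> K)\<close> odd for every pair
      \<open>(K, a)\<close> in \<open>Q\<close>.\<close>
    define J where "J = (\<lambda>j. if snd (e j) = 0 then I j else {1..m} - I j)"
    have eQ: "e j \<in> Q" if "j \<in> {1..k}" for j using e that by (rule bij_betwE[THEN bspec])
    have IF: "I j \<in> \<F>" if "j \<in> {1..k}" for j
      using subsetD[OF QD eQ[OF that]] by (cases "e j") (simp add: I_def D_def)
    have "inj_on (fst \<circ> e) {1..k}"
      using e inj_fst by (intro comp_inj_on) (simp_all add: bij_betw_def)
    then have "inj_on I {1..k}" by (simp add: I_def o_def)
    moreover have "I ` {1..k} \<subseteq> \<F>" using IF by blast
    moreover have "\<forall>j\<in>{1..k}. J j = I j \<or> J j = {1..m} - I j" by (auto simp: J_def)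
    ultimately have "(\<Inter>j\<in>{1..k}. J j) \<noteq> {}"
      using assms(4) unfolding k_independent_def by blast
    then obtain l where l: "\<And>j. j \<in> {1..k} \<Longrightarrow> l \<in> J j" by blast
    have par: "odd (a + of_bool (l \<in> K)) \<longleftrightarrow> True" if "(K, a) \<in> Q" for K a
    proof -
      have "(K, a) \<in> e ` {1..k}" using e that by (simp only: bij_betw_def)
      then obtain j where j: "(K, a) = e j" "j \<in> {1..k}" by (rule imageE)
      have "a \<in> {0, 1}" using that QD by (auto simp: D_def)
      moreover have "l \<in> (if a = 0 then K else {1..m} - K)"
        using l[OF j(2)] unfolding J_def I_def j(1)[symmetric] fst_conv snd_conv .
      ultimately show ?thesis by auto
    qed
    have "J 1 \<subseteq> {1..m}"
      using IF[of 1] F assms(2) by (auto simp: J_def)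
    then have lm: "l \<le> m" using l[of 1] assms(2) by auto
    have face: "(convex hull S) face_of P"
    proof -
      have "Q \<noteq> {}" using cQ assms(2) by auto
      then obtain A where A: "\<forall>q\<in>D. -1 \<le> A \<bullet> g q \<and> (A \<bullet> g q = -1 \<longleftrightarrow> q \<in> Q)"
        using functional[OF lm QD _ _ par] cQ by auto
      show ?thesis unfolding P
      proof (rule face_of_convex_hull_supporting[where A = A])
        fix z assume "z \<in> X"
        then obtain p where p: "p \<in> D" "z = g p" by (auto simp: X_def)
        show "-1 \<le> A \<bullet> z" using A p by blast
        show "A \<bullet> z = -1 \<longleftrightarrow> z \<in> S" using A p by (auto simp: Q_def)
      qed (use fin S(1) in auto)
    qed
    \<comment> \<open>Dropping one point from \<open>Q\<close> preserves the parity condition, so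
      some functional equals -1 on the others but not on it; \<open>k \<ge> 3\<close> keeps the rest
      nonempty.\<close>
    have indep: "\<not> affine_dependent S"
    proof (rule affine_independent_supporting[where b = "-1"])
      fix s assume "s \<in> S"
      then obtain q where q: "q \<in> Q" "s = g q" using gQ by auto
      have c: "card (Q - {q}) = k - 1" using q cQ finQ by simp
      have "\<exists>A. \<forall>p\<in>D. -1 \<le> A \<bullet> g p \<and> (A \<bullet> g p = -1 \<longleftrightarrow> p \<in> Q - {q})"
      proof (rule functional[OF lm, where b = True])
        show "Q - {q} \<noteq> {}"
        proof
          assume "Q - {q} = {}"
          with c have "k - 1 = 0" by (simp only: card.empty)
          then show False using assms(2) by simp
        qed
        show "card (Q - {q}) \<le> k" using c by simp
      qed (use QD par in blast)+
      then obtain A where A: "\<forall>p\<in>D. -1 \<le> A \<bullet> g p \<and> (A \<bullet> g p = -1 \<longleftrightarrow> p \<in> Q - {q})"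
        by blast
      have "A \<bullet> x = -1" if "x \<in> S - {s}" for x
      proof -
        have "x \<in> g ` Q" using that gQ by blast
        then obtain p where p: "p \<in> Q" "x = g p" by blast
        then have "p \<in> Q - {q}" using that q by blast
        then show ?thesis using A QD p by blast
      qed
      moreover have "A \<bullet> s \<noteq> -1" using A q QD by blast
      ultimately show "\<exists>A. (\<forall>x\<in>S - {s}. A \<bullet> x = -1) \<and> A \<bullet> s \<noteq> -1" by blast
    qed
    have "vertices (convex hull S) = S"
      unfolding vertices_def using extreme_point_of_convex_hull_affine_independent[OF indep] by auto
    moreover have "aff_dim (convex hull S) = int k - 1"
      using aff_dim_affine_independent[OF indep] S(3) by (simp add: aff_dim_convex_hull)
    ultimately show "\<exists>G. G face_of P \<and> vertices G = S \<and> aff_dim G = int k - 1"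
      using face by blast
  qed
  moreover have "polytope P" unfolding P using fin by (auto simp: polytope_def)
  moreover have "aff_dim P \<le> 2 * int k * (int m + 1) - 2 * int m * int ((k + 1) div 3)"
    unfolding assms(7) P_poly_def by (rule aff_dim_Psi[OF n])
  moreover have "card (vertices P) = 2 * card \<F>"
    unfolding vert X_def card_image[OF inj] by (simp add: D_def card_cartesian_product)
  ultimately show ?thesis by blast
qed

end
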